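(* Consider the Constrained regime of the RCPB policy with arrival parameter $0<\lambda<1$, memory parameter $c(n)=c$ for a fixed integer $c\ge1$, and idle-server message rate $\mu(n)=\mu=\alpha/(1-\lambda)$ for a fixed constant $\alpha>0$. Then the asymptotic delay is $$\mathbb{E}[W]=\lambda\left[1-\lambda+\frac{\alpha}{\lambda}+\cdots+\left(\frac{\alpha}{\lambda}\right)^c\right]^{-1}.$$
   Context: Model: for each $n\ge1$ there are $n$ parallel unit-rate servers, each with its own infinite-capacity FIFO queue (a job in service counts as being in queue); a server is idle iff its queue is empty. Jobs arrive as a Poisson process of rate $\lambda n$, with i.i.d. exponential mean-$1$ sizes independent of arrivals, and are dispatched immediately to a queue. Resource Constrained Pull-Based (RCPB) policy with parameters $c(n)\in\{1,\dots,n\}$ and $\mu(n)>0$: (a) the dispatcher stores up to $c(n)$ server IDs (tokens) in a virtual queue; (b) each idle server sends messages to the dispatcher as a Poisson process of rate $\mu(n)$; upon receipt the server's ID is added to the virtual queue unless it is already stored or the virtual queue is full, in which case the message is discarded; (c) an arriving job is sent, if there is at least one token, to the queue of a server whose ID is chosen uniformly at random among the stored tokens, and that token is deleted; if there are no tokens, it is sent to a uniformly random queue. (When $c(n)=c$ is constant, only $n\ge c$ is considered.) Let $Q^n_i(t)$ be the number of jobs in queue $i$, $M^n(t)$ the number of tokens. $(Q^n,M^n)$ is a positive recurrent continuous-time Markov chain on $\{(q,m)\in\mathbb{Z}_+^n\times\{0,\dots,c(n)\}:\ \sum_i\mathbf{1}_{\{q_i=0\}}\ge m\}$ with transition rates: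 $(q,0)\to(q+e_i,0)$ at rate $\lambda$; for $m>0$, $(q,m)\to(q+e_i,m-1)$ at rate $n\lambda\mathbf{1}_{\{q_i=0\}}/\sum_j\mathbf{1}_{\{q_j=0\}}$; $(q,m)\to(q-e_i,m)$ at rate $\mathbf{1}_{\{q_i>0\}}$; $(q,m)\to(q,m+1)$ at rate $\mu(n)(\sum_i\mathbf{1}_{\{q_i=0\}}-m)\mathbf{1}_{\{m<c(n)\}}$. $S^n_i$ is the fraction of queues with at least $i$ jobs. The queueing delay $\mathbb{E}[W^n]$ is the steady-state mean time that a job spends in queue until its service starts; by Little's law $\mathbb{E}[W^n]=\frac1\lambda\mathbb{E}\left[\sum_{i=1}^\infty S^n_i\right]-1$ (expectation under the stationary distribution). The asymptotic delay is $\mathbb{E}[W]=\limsup_{n\to\infty}\mathbb{E}[W^n]$. *)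

theory Defs
  imports "HOL-Probability.Probability"
begin

section \<open>Continuous-time Markov chains on a discrete state space\<close>

text \<open>The diagonal of \<open>r\<close> is ignored. The sum is an \<^const>\<open>infsum\<close> because \<^const>\<open>sum\<close> is
  \<open>0\<close> over an infinite set, even when only finitely many terms are nonzero.\<close>

definition generator :: "'s set \<Rightarrow> ('s \<Rightarrow> 's \<Rightarrow> real) \<Rightarrow> 's \<Rightarrow> 's \<Rightarrow> real" where
  "generator S r x y = (if x = y then - (\<Sum>\<^sub>\<infinity>z\<in>S - {x}. r x z) else r x y)"

text \<open>\<open>P t x\<close> is the law at time \<open>t\<close> of the chain started at \<open>x\<close>. The transition rates are the
  right derivatives at time \<open>0\<close>; when the total jump rates are bounded on \<open>S\<close>, they determine
  \<open>P\<close> on \<open>S\<close> uniquely.\<close>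

definition ctmc :: "'s set \<Rightarrow> ('s \<Rightarrow> 's \<Rightarrow> real) \<Rightarrow> (real \<Rightarrow> 's \<Rightarrow> 's pmf) \<Rightarrow> bool" where
  "ctmc S r P \<longleftrightarrow>
     (\<forall>x\<in>S. P 0 x = return_pmf x) \<and>
     (\<forall>t\<ge>0. \<forall>x\<in>S. set_pmf (P t x) \<subseteq> S) \<and>
     (\<forall>s\<ge>0. \<forall>t\<ge>0. \<forall>x\<in>S. P (s + t) x = bind_pmf (P s x) (P t)) \<and>
     (\<forall>x\<in>S. \<forall>y\<in>S.
        ((\<lambda>t. pmf (P t x) y) has_real_derivative generator S r x y) (at 0 within {0..}))"

definition stationary_distribution :: "'s set \<Rightarrow> (real \<Rightarrow> 's \<Rightarrow> 's pmf) \<Rightarrow> 's pmf \<Rightarrow> bool" where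
  "stationary_distribution S P p \<longleftrightarrow> set_pmf p \<subseteq> S \<and> (\<forall>t\<ge>0. bind_pmf p (P t) = p)"


section \<open>The Resource Constrained Pull-Based policy\<close>

text \<open>A state is \<open>(q, m)\<close>: the list \<open>q\<close> of the \<open>n\<close> queue lengths (indexed from \<open>0\<close>) and the
  number \<open>m\<close> of stored tokens.\<close>

type_synonym rcpb_state = "nat list \<times> nat"

definition idle :: "nat list \<Rightarrow> nat" where
  "idle q = card {i. i < length q \<and> q ! i = 0}"

definition rcpb_states :: "nat \<Rightarrow> nat \<Rightarrow> rcpb_state set" where
  "rcpb_states n c = {(q, m). length q = n \<and> m \<le> c \<and> m \<le> idle q}"

text \<open>The summands are, in order: an arrival finding no token, an arrival using a token, a service
  completion, and a message that is stored. Distinct transitions have distinct targets.\<close>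

definition rcpb_rate :: "real \<Rightarrow> nat \<Rightarrow> real \<Rightarrow> rcpb_state \<Rightarrow> rcpb_state \<Rightarrow> real" where
  "rcpb_rate lam c \<mu> = (\<lambda>(q, m) (q', m').
     (\<Sum>i<length q. if m = 0 \<and> m' = 0 \<and> q' = q[i := q ! i + 1] then lam else 0) +
     (\<Sum>i<length q. if m > 0 \<and> m' = m - 1 \<and> q' = q[i := q ! i + 1]
        then real (length q) * lam * of_bool (q ! i = 0) / real (idle q) else 0) +
     (\<Sum>i<length q. if m' = m \<and> q' = q[i := q ! i - 1] then of_bool (q ! i > 0) else 0) +
     (if m' = m + 1 \<and> q' = q then \<mu> * (real (idle q) - real m) * of_bool (m < c) else 0))"

definition rcpb_chain ::
  "real \<Rightarrow> nat \<Rightarrow> real \<Rightarrow> nat \<Rightarrow> (real \<Rightarrow> rcpb_state \<Rightarrow> rcpb_state pmf) \<Rightarrow> bool" where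
  "rcpb_chain lam c \<mu> n P \<longleftrightarrow> ctmc (rcpb_states n c) (rcpb_rate lam c \<mu>) P"

definition queue_fraction :: "nat \<Rightarrow> nat list \<Rightarrow> real" where
  "queue_fraction i q = real (card {j. j < length q \<and> q ! j \<ge> i}) / real (length q)"

text \<open>The mean steady-state queueing delay, expressed through Little's law. It is an extended real,
  so that an infinite mean would not be read as \<open>0\<close>.\<close>

definition mean_delay :: "real \<Rightarrow> rcpb_state pmf \<Rightarrow> ereal" where
  "mean_delay lam p =
     ereal (1 / lam) *
       enn2ereal (\<integral>\<^sup>+ (q, m). (\<Sum>i. ennreal (queue_fraction (Suc i) q)) \<partial>measure_pmf p) - 1"

definition asymptotic_delay :: "real \<Rightarrow> (nat \<Rightarrow> rcpb_state pmf) \<Rightarrow> ereal" where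
  "asymptotic_delay lam p = limsup (\<lambda>n. mean_delay lam (p n))"

end

theory Submission imports Defs begin

text \<open>
  Let \<open>s\<^sub>k\<close> be the fraction of queues with at least \<open>k\<close> jobs and \<open>Z\<close> the indicator that no token is
  stored. The proof never leaves the stationary law: it takes no fluid limit of paths and
  interchanges no limits of time and size. Its only dynamical input is that the
  generator applied to a bounded function has stationary mean \<open>0\<close>
  (\<open>stationary_expectation_generator\<close>).

  With \<open>f = s\<^sub>k\<close> the identity gives \<open>E s\<^sub>1 = lam\<close> and \<open>E s\<^sub>k\<^sub>+\<^sub>1 = lam E (Z s\<^sub>k)\<close> exactly
  (\<open>flow_balance\<close>), hence \<open>E s\<^sub>k \<le> lam\<^sup>k\<close> uniformly in \<open>n\<close>. Were \<open>Z\<close> a constant \<open>p\<^sup>*\<close>, the tails would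
  be the geometric sequence \<open>lam (lam p\<^sup>*)\<^sup>k\<close>, whose sum gives the asserted delay. So \<open>Z\<close> has to be
  decoupled from the queues, in two steps.

  The tokens move at speed \<open>n\<close> and the fractions \<open>s\<^sub>k\<close> at speed \<open>1\<close>. Test functions
  that multiply a slowly varying function of the queues with an indicator of the token count show that the
  token count is asymptotically in the equilibrium of a birth-death chain with rate ratio
  \<open>(\<mu> / lam) (1 - s\<^sub>1)\<close>. This lets one replace \<open>Z\<close> by a function \<open>p(s\<^sub>1)\<close>
  (\<open>no_token_averaging\<close>).

  It remains to see that \<open>s\<^sub>1\<close> concentrates at \<open>lam\<close>. The averaged drift of \<open>(s\<^sub>k)\<close> is that of a
  cooperative system: each level is helped by its neighbours, and \<open>p\<close> is increasing in \<open>s\<^sub>1\<close>. All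
  mass lost leaves through the bottom level, so the \<open>\<ell>\<^sup>1\<close> distance to the equilibrium decreases at
  rate at least \<open>\<bar>s\<^sub>1 - lam\<bar>\<close> (\<open>drift_inequality\<close>, with the distance smoothed and the
  levels truncated). In the stationary regime the mean drift is \<open>0\<close>, which forces
  \<open>E \<bar>s\<^sub>1 - lam\<bar>\<close> to \<open>0\<close> (\<open>concentration\<close>). Then \<open>E (Z s\<^sub>k)\<close> is asymptotically \<open>p(lam) E s\<^sub>k\<close>, and
  dominated convergence for series finishes the proof (\<open>asymptotic_delay_eq\<close>).
\<close>

section \<open>Stationarity and the generator\<close>

lemma expectation_bind_pmf_bounded:
  fixes f :: "'b \<Rightarrow> real"
  assumes "\<And>y. \<bar>f y\<bar> \<le> B"
  shows "measure_pmf.expectation (bind_pmf p K) f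
       = measure_pmf.expectation p (\<lambda>x. measure_pmf.expectation (K x) f)"
  unfolding measure_pmf_bind
  by (rule integral_bind[where K = "count_space UNIV" and B = B and B' = 1])
     (use assms in \<open>auto simp: measure_pmf.emeasure_space_1[simplified] space_subprob_algebra
        intro!: subprob_space_measure_pmf measure_pmf.finite_measure_axioms\<close>)

lemma ctmc_rate_limit:
  assumes "ctmc S r P" "x \<in> S" "y \<in> S" "t > 0"
  shows "(\<lambda>k. (pmf (P (t / real (Suc k)) x) y - of_bool (x = y)) / (t / real (Suc k)))
           \<longlonglongrightarrow> generator S r x y"
proof -
  have 0: "pmf (P 0 x) y = of_bool (x = y)"
    using assms by (auto simp: ctmc_def)
  have "((\<lambda>t. (pmf (P t x) y - pmf (P 0 x) y) / (t - 0)) \<longlongrightarrow> generator S r x y) (at 0 within {0..})"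
    using assms unfolding ctmc_def has_field_derivative_iff by blast
  moreover have "filterlim (\<lambda>k. t / real (Suc k)) (at 0 within {0..}) sequentially"
    unfolding filterlim_at using \<open>t > 0\<close>
    using LIMSEQ_Suc[OF lim_const_over_n[of t]] by (auto simp del: of_nat_Suc)
  ultimately show ?thesis
    unfolding 0 using filterlim_compose by fastforce
qed

lemma ctmc_holding_power:
  assumes "ctmc S r P" "x \<in> S" "t \<ge> 0"
  shows "pmf (P t x) x ^ k \<le> pmf (P (real k * t) x) x"
proof (induction k)
  case 0
  show ?case using assms by (simp add: ctmc_def)
next
  case (Suc k)
  have "P (real (Suc k) * t) x = bind_pmf (P t x) (P (real k * t))"
    using assms unfolding ctmc_def by (auto simp: algebra_simps)
  then have "pmf (P (real (Suc k) * t) x) x = (\<integral>y. pmf (P (real k * t) y) x \<partial>measure_pmf (P t x))"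
    by (simp add: pmf_bind)
  also have "\<dots> \<ge> (\<integral>y. pmf (P (real k * t) x) x * indicator {x} y \<partial>measure_pmf (P t x))"
    by (intro integral_mono measure_pmf.integrable_const_bound[where B = 1])
       (auto simp: pmf_le_1 indicator_def)
  also have "(\<integral>y. pmf (P (real k * t) x) x * indicator {x} y \<partial>measure_pmf (P t x))
      = pmf (P (real k * t) x) x * pmf (P t x) x"
    by (simp add: measure_pmf_single)
  finally show ?case
    using Suc mult_right_mono[OF Suc, of "pmf (P t x) x"] by (simp add: mult.commute)
qed

text \<open>A Bernoulli estimate along the partition of \<open>[0, t]\<close> into \<open>k\<close> equal steps turns the right
  derivative at \<open>0\<close> into a bound that is linear in \<open>t\<close> for every \<open>t\<close>. It supplies the dominating
  constant when the generator is obtained as a limit under the stationary law.\<close>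

lemma ctmc_leave_bound:
  assumes "ctmc S r P" "x \<in> S" "t \<ge> 0"
  shows "1 - pmf (P t x) x \<le> - generator S r x x * t"
proof (cases "t = 0")
  case True
  then show ?thesis using assms by (simp add: ctmc_def)
next
  case False
  with assms have t: "t > 0" by simp
  define h where "h k = t / real (Suc k)" for k
  have hk: "real (Suc k) * h k = t" "h k > 0" for k
    using t by (auto simp: h_def simp del: of_nat_Suc)
  have "1 - pmf (P t x) x \<le> - ((pmf (P (h k) x) x - of_bool (x = x)) / h k) * t" for k
  proof -
    have "1 + real (Suc k) * (pmf (P (h k) x) x - 1) \<le> (1 + (pmf (P (h k) x) x - 1)) ^ Suc k"
      by (rule Bernoulli_inequality) simp
    also have "\<dots> \<le> pmf (P t x) x"
      using ctmc_holding_power[OF assms(1,2), of "h k" "Suc k"] hk[of k] by simp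
    finally have "1 - pmf (P t x) x \<le> real (Suc k) * (1 - pmf (P (h k) x) x)"
      by (simp add: algebra_simps)
    also have "real (Suc k) = t / h k" using hk[of k] by (simp add: field_simps)
    finally show ?thesis using hk(2)[of k] by (simp add: field_simps)
  qed
  moreover have "(\<lambda>k. - ((pmf (P (h k) x) x - of_bool (x = x)) / h k) * t) \<longlonglongrightarrow> - generator S r x x * t"
    unfolding h_def by (intro tendsto_intros ctmc_rate_limit assms t)
  ultimately show ?thesis by (intro LIMSEQ_le_const) auto
qed

lemma generator_diag:
  assumes "finite N" "\<And>y. y \<in> S - {x} \<Longrightarrow> y \<notin> N \<Longrightarrow> r x y = 0" "N \<subseteq> S - {x}"
  shows "generator S r x x = - (\<Sum>y\<in>N. r x y)"
proof -
  have "(\<Sum>\<^sub>\<infinity>z\<in>S - {x}. r x z) = (\<Sum>\<^sub>\<infinity>z\<in>N. r x z)"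
    using assms by (intro infsum_cong_neutral) auto
  then show ?thesis using assms by (simp add: generator_def)
qed

text \<open>The mass that \<open>P t x\<close> puts outside \<open>x\<close> and its finitely many neighbours is \<open>o(t)\<close>: the rates
  towards the neighbours already add up to the total exit rate.\<close>

lemma ctmc_generator_limit:
  fixes f :: "'s \<Rightarrow> real"
  assumes ct: "ctmc S r P" and x: "x \<in> S" and N: "finite N" "N \<subseteq> S - {x}"
    and r0: "\<And>y. y \<in> S - {x} \<Longrightarrow> y \<notin> N \<Longrightarrow> r x y = 0"
    and B: "\<And>y. \<bar>f y\<bar> \<le> B"
  shows "(\<lambda>k. (measure_pmf.expectation (P (1 / real (Suc k)) x) f - f x) / (1 / real (Suc k)))
           \<longlonglongrightarrow> (\<Sum>y\<in>N. r x y * (f y - f x))"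
proof -
  define h where "h k = 1 / real (Suc k)" for k
  have h: "h k > 0" for k by (simp add: h_def)
  define D where "D k = (\<Sum>y\<in>N. pmf (P (h k) x) y / h k * (f y - f x))" for k
  define R where "R k = 2 * B * ((1 - pmf (P (h k) x) x) / h k - (\<Sum>y\<in>N. pmf (P (h k) x) y / h k))" for k
  have int: "integrable (measure_pmf M) g" if "\<And>y. \<bar>g y\<bar> \<le> C" for M :: "'s pmf" and g :: "'s \<Rightarrow> real" and C
    using that by (intro measure_pmf.integrable_const_bound[where B = C]) auto
  have lim: "(\<lambda>k. pmf (P (h k) x) y / h k) \<longlonglongrightarrow> r x y" if "y \<in> N" for y
  proof -
    have "y \<in> S" "x \<noteq> y" using that N by auto
    then show ?thesis
      using ctmc_rate_limit[OF ct x, of y 1] by (simp add: h_def generator_def del: of_nat_Suc)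
  qed
  have lim1: "(\<lambda>k. (1 - pmf (P (h k) x) x) / h k) \<longlonglongrightarrow> (\<Sum>y\<in>N. r x y)"
  proof -
    have "(1 - pmf (P (h k) x) x) / h k = - ((pmf (P (h k) x) x - of_bool (x = x)) / h k)" for k
      by (simp add: minus_divide_left)
    then show ?thesis
      using tendsto_minus[OF ctmc_rate_limit[OF ct x x, of 1]] generator_diag[where r = r, OF N(1) r0 N(2)]
      by (simp add: h_def)
  qed
  have "(\<lambda>k. D k) \<longlonglongrightarrow> (\<Sum>y\<in>N. r x y * (f y - f x))"
    unfolding D_def by (intro tendsto_intros lim)
  moreover have "R \<longlonglongrightarrow> 2 * B * ((\<Sum>y\<in>N. r x y) - (\<Sum>y\<in>N. r x y))"
    unfolding R_def by (intro tendsto_intros lim lim1)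
  then have R0: "R \<longlonglongrightarrow> 0" by simp
  have bd: "\<bar>(measure_pmf.expectation (P (h k) x) f - f x) / h k - D k\<bar> \<le> R k" for k
  proof -
    let ?M = "P (h k) x"
    have fd: "\<bar>f y - f x\<bar> \<le> 2 * B" for y using B[of y] B[of x] by linarith
    have B0: "B \<ge> 0" using B[of x] by linarith
    have "measure_pmf.expectation ?M f - f x = (\<integral>y. f y - f x \<partial>measure_pmf ?M)"
      using int[OF B] by simp
    also have "\<dots> = (\<integral>y. indicator N y * (f y - f x) + indicator (- insert x N) y * (f y - f x) \<partial>measure_pmf ?M)"
      using N by (intro Bochner_Integration.integral_cong) (auto simp: indicator_def)
    also have "\<dots> = (\<integral>y. indicator N y * (f y - f x) \<partial>measure_pmf ?M)
         + (\<integral>y. indicator (- insert x N) y * (f y - f x) \<partial>measure_pmf ?M)"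
      using fd B0 by (intro Bochner_Integration.integral_add int[where C = "2 * B"]) (auto simp: indicator_def)
    also have "(\<integral>y. indicator N y * (f y - f x) \<partial>measure_pmf ?M) = h k * D k"
      using h[of k] N by (subst integral_measure_pmf_real[of N])
        (auto simp: indicator_def D_def sum_distrib_left mult_ac split: if_splits intro!: sum.cong)
    finally have eq: "measure_pmf.expectation ?M f - f x - h k * D k
        = (\<integral>y. indicator (- insert x N) y * (f y - f x) \<partial>measure_pmf ?M)" by simp
    have "\<bar>\<integral>y. indicator (- insert x N) y * (f y - f x) \<partial>measure_pmf ?M\<bar>
        \<le> (\<integral>y. 2 * B * indicator (- insert x N) y \<partial>measure_pmf ?M)"
      using fd B0 by (intro order_trans[OF integral_abs_bound] integral_mono int[where C = "2 * B"])
         (auto simp: indicator_def)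
    also have "\<dots> = 2 * B * measure_pmf.prob ?M (- insert x N)" by simp
    also have "measure_pmf.prob ?M (- insert x N) = 1 - measure_pmf.prob ?M (insert x N)"
      by (subst measure_pmf.prob_compl[symmetric]) (auto simp: Compl_eq_Diff_UNIV)
    also have "measure_pmf.prob ?M (insert x N) = pmf ?M x + (\<Sum>y\<in>N. pmf ?M y)"
      using N by (subst measure_measure_pmf_finite) (auto simp: sum.insert_if)
    also have "2 * B * (1 - (pmf ?M x + (\<Sum>y\<in>N. pmf ?M y))) = h k * R k"
      using h[of k] by (simp add: R_def sum_divide_distrib[symmetric] field_simps)
    finally have "\<bar>measure_pmf.expectation ?M f - f x - h k * D k\<bar> \<le> h k * R k" unfolding eq .
    moreover have "measure_pmf.expectation ?M f - f x - h k * D k =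
        h k * ((measure_pmf.expectation ?M f - f x) / h k - D k)"
      using h[of k] by (simp add: field_simps)
    ultimately show ?thesis using h[of k] by (simp add: abs_mult)
  qed
  have "(\<lambda>k. (measure_pmf.expectation (P (h k) x) f - f x) / h k - D k) \<longlonglongrightarrow> 0"
    by (rule Lim_null_comparison[OF _ R0]) (use bd in auto)
  from tendsto_add[OF this calculation] show ?thesis by (simp add: h_def)
qed

text \<open>Under the stationary law the difference quotient of \<open>P t f\<close> has mean \<open>0\<close> for each \<open>t\<close>, and it is
  bounded by a multiple of the total jump rate, so its limit has mean \<open>0\<close> as well. Every fact about
  the stationary law below is this identity for a suitable \<open>f\<close>.\<close>

lemma stationary_expectation_generator:
  fixes f :: "'s \<Rightarrow> real"
  assumes ct: "ctmc S r P" and st: "stationary_distribution S P p"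
    and N: "\<And>x. x \<in> S \<Longrightarrow> finite (N x)"
    and r0: "\<And>x y. x \<in> S \<Longrightarrow> y \<notin> N x \<inter> S \<Longrightarrow> r x y = 0"
    and r: "\<And>x y. x \<in> S \<Longrightarrow> r x y \<ge> 0"
    and \<Lambda>: "\<And>x. x \<in> S \<Longrightarrow> (\<Sum>y\<in>N x. r x y) \<le> \<Lambda>"
    and B: "\<And>y. \<bar>f y\<bar> \<le> B"
  shows "measure_pmf.expectation p (\<lambda>x. \<Sum>y\<in>N x. r x y * (f y - f x)) = 0"
proof -
  define h where "h k = 1 / real (Suc k)" for k
  have h: "h k > 0" for k by (simp add: h_def)
  define g where "g k x = (measure_pmf.expectation (P (h k) x) f - f x) / h k" for k x
  have B0: "B \<ge> 0" using B[of undefined] by linarith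
  have pS: "set_pmf p \<subseteq> S" using st by (simp add: stationary_distribution_def)
  have int: "integrable (measure_pmf M) u" if "\<And>y. \<bar>u y\<bar> \<le> C" for M :: "'s pmf" and u :: "'s \<Rightarrow> real" and C
    using that by (intro measure_pmf.integrable_const_bound[where B = C]) auto
  have Ef: "\<bar>measure_pmf.expectation M f\<bar> \<le> B" for M
    by (rule order_trans[OF integral_abs_bound], rule order_trans[OF integral_mono[OF _ _ B]])
       (auto intro: int[OF B])
  have g0: "measure_pmf.expectation p (g k) = 0" for k
  proof -
    have "measure_pmf.expectation p (\<lambda>x. measure_pmf.expectation (P (h k) x) f)
        = measure_pmf.expectation (bind_pmf p (P (h k))) f"
      by (rule expectation_bind_pmf_bounded[OF B, symmetric])
    also have "bind_pmf p (P (h k)) = p"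
      using st h[of k] by (simp add: stationary_distribution_def)
    finally show ?thesis
      unfolding g_def using int[OF Ef, of p "\<lambda>x. P (h k) x"] int[OF B] by simp
  qed
  let ?N = "\<lambda>x. N x \<inter> S - {x}"
  have sumN: "(\<Sum>y\<in>?N x. r x y * (f y - f x)) = (\<Sum>y\<in>N x. r x y * (f y - f x))" if "x \<in> S" for x
    using that N r0 by (intro sum.mono_neutral_left) auto
  have lim: "(\<lambda>k. g k x) \<longlonglongrightarrow> (\<Sum>y\<in>N x. r x y * (f y - f x))" if "x \<in> S" for x
    unfolding sumN[OF that, symmetric] g_def h_def
    by (rule ctmc_generator_limit[OF ct that _ _ _ B]) (use N r0 that in auto)
  have bd: "\<bar>g k x\<bar> \<le> 2 * B * \<Lambda>" if x: "x \<in> S" for k x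
  proof -
    let ?M = "P (h k) x"
    have "\<bar>measure_pmf.expectation ?M f - f x\<bar> = \<bar>\<integral>y. f y - f x \<partial>measure_pmf ?M\<bar>"
      using int[OF B] by simp
    also have "\<dots> \<le> (\<integral>y. 2 * B * indicator (- {x}) y \<partial>measure_pmf ?M)"
    proof (rule order_trans[OF integral_abs_bound], rule integral_mono)
      show "integrable (measure_pmf ?M) (\<lambda>y. \<bar>f y - f x\<bar>)"
      proof (rule int)
        show "\<bar>\<bar>f y - f x\<bar>\<bar> \<le> 2 * B" for y using B[of y] B[of x] by linarith
      qed
      show "integrable (measure_pmf ?M) (\<lambda>y. 2 * B * indicator (- {x}) y)"
        using B0 by (intro int[where C = "2 * B"]) (auto simp: indicator_def)
      show "\<bar>f y - f x\<bar> \<le> 2 * B * indicator (- {x}) y" for y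
        using B[of y] B[of x] by (auto simp: indicator_def)
    qed
    also have "\<dots> = 2 * B * (1 - pmf ?M x)"
      by (simp add: measure_pmf.prob_compl[symmetric] Compl_eq_Diff_UNIV measure_pmf_single[symmetric])
    also have "\<dots> \<le> 2 * B * (\<Lambda> * h k)"
    proof -
      have "1 - pmf ?M x \<le> - generator S r x x * h k"
        using ctmc_leave_bound[OF ct x] h[of k] by simp
      also have "- generator S r x x = (\<Sum>y\<in>?N x. r x y)"
        by (subst generator_diag[where N = "?N x"]) (use N r0 x in auto)
      also have "\<dots> \<le> (\<Sum>y\<in>N x. r x y)"
        using N r x by (intro sum_mono2) auto
      finally have "1 - pmf ?M x \<le> \<Lambda> * h k"
        using \<Lambda>[OF x] h[of k] by (meson less_eq_real_def mult_right_mono order_trans)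
      then show ?thesis using B0 by (simp add: mult_left_mono)
    qed
    finally show ?thesis using h[of k] by (simp add: g_def abs_divide field_simps)
  qed
  have "(\<lambda>k. measure_pmf.expectation p (g k))
      \<longlonglongrightarrow> measure_pmf.expectation p (\<lambda>x. \<Sum>y\<in>N x. r x y * (f y - f x))"
    using pS by (intro integral_dominated_convergence[where w = "\<lambda>_. 2 * B * \<Lambda>"])
      (auto simp: AE_measure_pmf_iff intro: lim bd)
  then show ?thesis by (simp add: g0 LIMSEQ_const_iff)
qed

section \<open>The generator of the RCPB chain\<close>

text \<open>In both cases an arrival leads to \<open>(q[i := q ! i + 1], m - 1)\<close>: truncated subtraction keeps
  \<open>m = 0\<close> at \<open>0\<close>. This gives the generator a single arrival term.\<close>

definition arrival_rate :: "real \<Rightarrow> nat list \<Rightarrow> nat \<Rightarrow> nat \<Rightarrow> real" where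
  "arrival_rate lam q m i =
     (if m = 0 then lam else real (length q) * lam * of_bool (q ! i = 0) / real (idle q))"

definition rcpb_gen :: "real \<Rightarrow> nat \<Rightarrow> real \<Rightarrow> (rcpb_state \<Rightarrow> real) \<Rightarrow> rcpb_state \<Rightarrow> real" where
  "rcpb_gen lam c \<mu> f = (\<lambda>(q, m).
     (\<Sum>i<length q. arrival_rate lam q m i * (f (q[i := q ! i + 1], m - 1) - f (q, m))) +
     (\<Sum>i<length q. of_bool (q ! i > 0) * (f (q[i := q ! i - 1], m) - f (q, m))) +
     \<mu> * (real (idle q) - real m) * of_bool (m < c) * (f (q, m + 1) - f (q, m)))"

definition rcpb_targets :: "rcpb_state \<Rightarrow> rcpb_state set" where
  "rcpb_targets = (\<lambda>(q, m).
     (\<lambda>i. (q[i := q ! i + 1], m - 1)) ` {..<length q} \<union>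
     (\<lambda>i. (q[i := q ! i - 1], m)) ` {..<length q} \<union> {(q, m + 1)})"

lemma rcpb_rate_alt:
  "rcpb_rate lam c \<mu> (q, m) y =
     (\<Sum>i<length q. if y = (q[i := q ! i + 1], m - 1) then arrival_rate lam q m i else 0) +
     (\<Sum>i<length q. if y = (q[i := q ! i - 1], m) then of_bool (q ! i > 0) else 0) +
     (if y = (q, m + 1) then \<mu> * (real (idle q) - real m) * of_bool (m < c) else 0)"
  unfolding rcpb_rate_def arrival_rate_def
  by (cases y; cases "m = 0") (auto intro!: arg_cong2[where f = "(+)"] sum.cong)

text \<open>Targets that coincide cause no harm, since contributions are added per transition and not per
  target. In particular a departure from an empty queue may be listed as a transition of rate \<open>0\<close>
  to the state itself.\<close>

lemma sum_over_targets:
  fixes a :: "'i \<Rightarrow> real"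
  assumes "finite N" "u ` I \<subseteq> N"
  shows "(\<Sum>y\<in>N. (\<Sum>i\<in>I. if y = u i then a i else 0) * g y) = (\<Sum>i\<in>I. a i * g (u i))"
proof -
  have "(\<Sum>y\<in>N. (\<Sum>i\<in>I. if y = u i then a i else 0) * g y)
      = (\<Sum>i\<in>I. \<Sum>y\<in>N. (if y = u i then a i else 0) * g y)"
    by (simp add: sum_distrib_right) (rule sum.swap)
  also have "\<dots> = (\<Sum>i\<in>I. \<Sum>y\<in>N. if y = u i then a i * g (u i) else 0)"
    by (intro sum.cong) auto
  also have "\<dots> = (\<Sum>i\<in>I. a i * g (u i))"
    using assms by (intro sum.cong) auto
  finally show ?thesis .
qed

lemma finite_rcpb_targets: "finite (rcpb_targets x)"
  by (cases x) (simp add: rcpb_targets_def)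

lemma sum_rcpb_rate:
  "(\<Sum>y\<in>rcpb_targets (q, m). rcpb_rate lam c \<mu> (q, m) y * g y) =
     (\<Sum>i<length q. arrival_rate lam q m i * g (q[i := q ! i + 1], m - 1)) +
     (\<Sum>i<length q. of_bool (q ! i > 0) * g (q[i := q ! i - 1], m)) +
     \<mu> * (real (idle q) - real m) * of_bool (m < c) * g (q, m + 1)"
proof -
  let ?N = "rcpb_targets (q, m)"
  note fin = finite_rcpb_targets[of "(q, m)"]
  have "(\<Sum>y\<in>?N. (if y = (q, m + 1) then \<mu> * (real (idle q) - real m) * of_bool (m < c) else 0) * g y)
     = \<mu> * (real (idle q) - real m) * of_bool (m < c) * g (q, m + 1)"
    using sum_over_targets[OF fin, of "\<lambda>_. (q, m + 1)" "{0::nat}"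
        "\<lambda>_. \<mu> * (real (idle q) - real m) * of_bool (m < c)" g]
    by (simp add: rcpb_targets_def)
  then show ?thesis
    unfolding rcpb_rate_alt distrib_right sum.distrib
    by (subst (1 2) sum_over_targets[OF fin]) (auto simp: rcpb_targets_def)
qed

lemma card_list_update:
  assumes "i < length q"
  shows "real (card {j. j < length q \<and> Q (q[i := v] ! j)})
       = real (card {j. j < length q \<and> Q (q ! j)}) + of_bool (Q v) - of_bool (Q (q ! i))"
proof -
  have card: "real (card {j. j < length q \<and> R j}) = (\<Sum>j<length q. of_bool (R j))" for R
  proof -
    have "{j. j < length q \<and> R j} = {..<length q} \<inter> {j. R j}" by auto
    then show ?thesis by (simp add: sum.If_cases of_bool_def)
  qed
  have "(\<Sum>j<length q. of_bool (Q (q[i := v] ! j)) :: real)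
     = (\<Sum>j<length q. of_bool (Q (q ! j)) + (if j = i then of_bool (Q v) - of_bool (Q (q ! i)) else 0))"
    by (intro sum.cong) auto
  also have "\<dots> = (\<Sum>j<length q. of_bool (Q (q ! j))) + (of_bool (Q v) - of_bool (Q (q ! i)))"
    using assms by (simp add: sum.distrib)
  finally show ?thesis unfolding card by simp
qed

lemma idle_update:
  "i < length q \<Longrightarrow> real (idle (q[i := v])) = real (idle q) + of_bool (v = 0) - of_bool (q ! i = 0)"
  unfolding idle_def using card_list_update[of i q "\<lambda>x. x = 0" v] by simp

lemma queue_fraction_update:
  "i < length q \<Longrightarrow> queue_fraction k (q[i := v])
     = queue_fraction k q + (of_bool (k \<le> v) - of_bool (k \<le> q ! i)) / real (length q)"
  unfolding queue_fraction_def using card_list_update[of i q "\<lambda>x. k \<le> x" v]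
  by (simp add: add_divide_distrib diff_divide_distrib)

lemma queue_fraction_nonneg: "0 \<le> queue_fraction k q"
  and queue_fraction_le_1: "queue_fraction k q \<le> 1"
proof -
  have "card {j. j < length q \<and> k \<le> q ! j} \<le> card {..<length q}"
    by (intro card_mono) auto
  then show "queue_fraction k q \<le> 1"
    by (simp add: queue_fraction_def divide_le_eq_1)
qed (simp add: queue_fraction_def)

lemma queue_fraction_0: "q \<noteq> [] \<Longrightarrow> queue_fraction 0 q = 1"
  by (simp add: queue_fraction_def)

lemma queue_fraction_antimono: "k \<le> l \<Longrightarrow> queue_fraction l q \<le> queue_fraction k q"
  unfolding queue_fraction_def by (intro divide_right_mono) (auto intro!: card_mono)

lemma card_queue_eq_fraction:
  "(\<Sum>i<length q. of_bool (q ! i = k)) = real (length q) * (queue_fraction k q - queue_fraction (Suc k) q)"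
proof (cases "q = []")
  case False
  let ?A = "\<lambda>k. {j. j < length q \<and> k \<le> q ! j}"
  have "(\<Sum>i<length q. of_bool (q ! i = k) :: real) = real (card {j. j < length q \<and> q ! j = k})"
  proof -
    have "{j. j < length q \<and> q ! j = k} = {..<length q} \<inter> {j. q ! j = k}" by auto
    then show ?thesis by (simp add: sum.If_cases of_bool_def)
  qed
  also have "{j. j < length q \<and> q ! j = k} = ?A k - ?A (Suc k)" by auto
  also have "real (card \<dots>) = real (card (?A k)) - real (card (?A (Suc k)))"
    by (subst card_Diff_subset) (auto intro!: of_nat_diff card_mono)
  finally show ?thesis using False by (simp add: queue_fraction_def right_diff_distrib del: sum_of_bool_eq)
qed simp

lemma idle_queue_fraction: "real (idle q) = real (length q) * (1 - queue_fraction 1 q)"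
proof (cases "q = []")
  case False
  have "{i. i < length q \<and> q ! i = 0} = {..<length q} \<inter> {i. q ! i = 0}" by auto
  then have "real (idle q) = (\<Sum>i<length q. of_bool (q ! i = 0))"
    by (simp add: idle_def sum.If_cases of_bool_def)
  then show ?thesis using card_queue_eq_fraction[of q 0] False by (simp add: queue_fraction_0)
qed (simp add: idle_def)

lemma sum_arrival_rate_eq:
  assumes "(q, m) \<in> rcpb_states n c" "n > 0"
  shows "(\<Sum>i<length q. arrival_rate lam q m i * of_bool (q ! i = k)) = real n *
     (if m = 0 then lam * (queue_fraction k q - queue_fraction (Suc k) q) else lam * of_bool (k = 0))"
proof (cases "m = 0")
  case True
  then show ?thesis using assms card_queue_eq_fraction[of q k]
    by (auto simp: arrival_rate_def sum_distrib_left[symmetric] rcpb_states_def simp del: sum_of_bool_eq)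
next
  case False
  with assms have i: "idle q > 0" "length q = n" by (auto simp: rcpb_states_def)
  have "(\<Sum>i<length q. arrival_rate lam q m i * of_bool (q ! i = k))
      = (\<Sum>i<length q. (n * lam * of_bool (k = 0) / idle q) * of_bool (q ! i = 0))"
    using False i by (intro sum.cong) (auto simp: arrival_rate_def)
  also have "\<dots> = (n * lam * of_bool (k = 0) / idle q) * idle q"
  proof -
    have "(\<Sum>i<length q. of_bool (q ! i = 0)) = real (idle q)"
      using card_queue_eq_fraction[of q 0] i assms(2) by (auto simp: idle_queue_fraction queue_fraction_0)
    then show ?thesis by (simp only: sum_distrib_left[symmetric])
  qed
  finally show ?thesis using False i by simp
qed

lemma sum_arrival_rate:
  assumes "(q, m) \<in> rcpb_states n c"
  shows "(\<Sum>i<length q. arrival_rate lam q m i) = real n * lam"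
proof (cases "m = 0")
  case True
  then show ?thesis using assms by (simp add: arrival_rate_def rcpb_states_def)
next
  case False
  with assms have "idle q > 0" "length q = n" by (auto simp: rcpb_states_def)
  then have "n > 0" by (auto simp: idle_def)
  have "(\<Sum>i<length q. arrival_rate lam q m i)
      = (\<Sum>i<length q. arrival_rate lam q m i * of_bool (q ! i = 0))"
    using False by (intro sum.cong) (auto simp: arrival_rate_def)
  also have "\<dots> = real n * lam"
    by (subst sum_arrival_rate_eq[OF assms \<open>n > 0\<close>]) (use False in simp)
  finally show ?thesis .
qed

lemma arrival_rate_nonneg: "lam \<ge> 0 \<Longrightarrow> arrival_rate lam q m i \<ge> 0"
  by (simp add: arrival_rate_def)

lemma rcpb_rate_outside_states:
  assumes "(q, m) \<in> rcpb_states n c" and "y \<notin> rcpb_states n c"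
  shows "rcpb_rate lam c \<mu> (q, m) y = 0"
proof -
  have up: "(q[i := q ! i + 1], m - 1) \<in> rcpb_states n c" if "i < length q" for i
    using assms(1) idle_update[OF that, of "q ! i + 1"]
    by (auto simp: rcpb_states_def of_bool_def split: if_splits)
  have down: "(q[i := q ! i - 1], m) \<in> rcpb_states n c" if "i < length q" for i
    using assms(1) idle_update[OF that, of "q ! i - 1"]
    by (auto simp: rcpb_states_def of_bool_def split: if_splits)
  have msg: "(real (idle q) - real m) * of_bool (m < c) = 0" if "(q, m + 1) \<notin> rcpb_states n c"
    using assms(1) that by (auto simp: rcpb_states_def)
  show ?thesis
  proof -
    have "(\<Sum>i<length q. if y = (q[i := q ! i + 1], m - 1) then arrival_rate lam q m i else 0) = 0"
      using assms(2) up by (intro sum.neutral) auto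
    moreover have "(\<Sum>i<length q. if y = (q[i := q ! i - 1], m) then of_bool (q ! i > 0) else 0) = (0::real)"
      using assms(2) down by (intro sum.neutral) auto
    moreover have "(if y = (q, m + 1) then \<mu> * (real (idle q) - real m) * of_bool (m < c) else 0) = 0"
      using assms(2) msg by (auto simp: of_bool_def)
    ultimately show ?thesis unfolding rcpb_rate_alt by simp
  qed
qed

lemma stationary_rcpb_gen:
  assumes ch: "rcpb_chain lam c \<mu> n P" and st: "stationary_distribution (rcpb_states n c) P p"
    and lam: "lam \<ge> 0" and mu: "\<mu> \<ge> 0" and B: "\<And>x. \<bar>f x\<bar> \<le> B"
  shows "measure_pmf.expectation p (rcpb_gen lam c \<mu> f) = 0"
proof -
  let ?S = "rcpb_states n c" and ?r = "rcpb_rate lam c \<mu>"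
  have eq: "(\<Sum>y\<in>rcpb_targets x. ?r x y * (f y - f x)) = rcpb_gen lam c \<mu> f x" for x
    by (cases x) (simp add: sum_rcpb_rate rcpb_gen_def)
  have "measure_pmf.expectation p (\<lambda>x. \<Sum>y\<in>rcpb_targets x. ?r x y * (f y - f x)) = 0"
  proof (rule stationary_expectation_generator[where N = rcpb_targets and f = f and B = B
        and \<Lambda> = "real n * lam + real n + \<mu> * real n"])
    show "ctmc ?S ?r P" using ch by (simp add: rcpb_chain_def)
    show "?r x y = 0" if "x \<in> ?S" "y \<notin> rcpb_targets x \<inter> ?S" for x y
    proof (cases "y \<in> ?S")
      case True
      obtain q m where x: "x = (q, m)" by fastforce
      with that True have y: "y \<noteq> (q, m + 1)" "\<And>i. i < length q \<Longrightarrow> y \<noteq> (q[i := q ! i + 1], m - 1)"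
        "\<And>i. i < length q \<Longrightarrow> y \<noteq> (q[i := q ! i - 1], m)"
        by (auto simp: rcpb_targets_def)
      then show ?thesis unfolding x rcpb_rate_alt by simp
    next
      case False
      then show ?thesis using that by (cases x) (auto intro: rcpb_rate_outside_states)
    qed
    show "?r x y \<ge> 0" if "x \<in> ?S" for x y
    proof -
      obtain q m where x: "x = (q, m)" by fastforce
      with that have "m \<le> idle q" by (simp add: rcpb_states_def)
      then show ?thesis using lam mu unfolding x rcpb_rate_alt
        by (auto intro!: add_nonneg_nonneg sum_nonneg simp: arrival_rate_nonneg)
    qed
    show "(\<Sum>y\<in>rcpb_targets x. ?r x y) \<le> real n * lam + real n + \<mu> * real n" if "x \<in> ?S" for x
    proof -
      obtain q m where x: "x = (q, m)" by fastforce
      with that have q: "length q = n" by (simp add: rcpb_states_def)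
      have "(\<Sum>i<length q. of_bool (q ! i > 0) :: real) \<le> (\<Sum>i<length q. 1)"
        by (intro sum_mono) auto
      moreover have "real (idle q) \<le> real n"
        using queue_fraction_nonneg[of 1 q] q by (simp add: idle_queue_fraction mult_left_le)
      then have "\<mu> * ((real (idle q) - real m) * of_bool (m < c)) \<le> \<mu> * real n"
        using mu by (intro mult_left_mono) (auto simp: of_bool_def)
      moreover have "(\<Sum>i<length q. arrival_rate lam q m i) = real n * lam"
        using that by (intro sum_arrival_rate) (simp add: x)
      ultimately show ?thesis
        using sum_rcpb_rate[of lam c \<mu> q m "\<lambda>_. 1"] q by (simp add: x mult.assoc)
    qed
  qed (use st B finite_rcpb_targets in auto)
  then show ?thesis by (simp add: eq)
qed

text \<open>A jump moves the fraction of queues with more than \<open>k\<close> jobs by \<open>1 / n\<close>, upwards if the arrival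
  joins a queue of length \<open>k\<close>, downwards if the departure leaves a queue of length \<open>k + 1\<close>. An
  arrival that uses a token always joins an empty queue.\<close>

lemma rcpb_gen_queue_fraction:
  assumes S: "(q, m) \<in> rcpb_states n c" and n: "n > 0"
  shows "rcpb_gen lam c \<mu> (\<lambda>(q, m). h (queue_fraction (Suc k) q)) (q, m) =
     real n * (if m = 0 then lam * (queue_fraction k q - queue_fraction (Suc k) q) else lam * of_bool (k = 0))
        * (h (queue_fraction (Suc k) q + 1 / n) - h (queue_fraction (Suc k) q))
     + real n * (queue_fraction (Suc k) q - queue_fraction (Suc (Suc k)) q)
        * (h (queue_fraction (Suc k) q - 1 / n) - h (queue_fraction (Suc k) q))"
proof -
  let ?u = "queue_fraction (Suc k) q"
  have q: "length q = n" using S by (simp add: rcpb_states_def)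
  have "(\<Sum>i<length q. arrival_rate lam q m i * (h (queue_fraction (Suc k) (q[i := q ! i + 1])) - h ?u))
      = (\<Sum>i<length q. arrival_rate lam q m i * of_bool (q ! i = k) * (h (?u + 1 / n) - h ?u))"
    by (intro sum.cong) (auto simp: queue_fraction_update q of_bool_def)
  moreover have "(\<Sum>i<length q. of_bool (q ! i > 0) * (h (queue_fraction (Suc k) (q[i := q ! i - 1])) - h ?u))
      = (\<Sum>i<length q. of_bool (q ! i = Suc k) * (h (?u - 1 / n) - h ?u))"
    by (intro sum.cong) (auto simp: queue_fraction_update q of_bool_def)
  ultimately show ?thesis
    using sum_arrival_rate_eq[OF S n, of lam k] card_queue_eq_fraction[of q "Suc k"]
    by (simp add: rcpb_gen_def sum_distrib_right[symmetric] q)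
qed

section \<open>Slow observables and the token count\<close>

text \<open>Observables of the queues that a change of a single queue moves by \<open>O(1 / n)\<close> only, with a bound
  that does not depend on the number \<open>n\<close> of queues. On the time scale \<open>1 / n\<close> of the tokens they
  are frozen.\<close>

definition slow :: "(nat list \<Rightarrow> real) \<Rightarrow> bool" where
  "slow G \<longleftrightarrow> (\<exists>B. \<forall>q. \<bar>G q\<bar> \<le> B \<and>
     (\<forall>i<length q. \<forall>v. \<bar>G (q[i := v]) - G q\<bar> \<le> B / real (length q)))"

lemma slowE:
  assumes "slow G"
  obtains B where "\<And>q. \<bar>G q\<bar> \<le> B"
    "\<And>q i v. i < length q \<Longrightarrow> \<bar>G (q[i := v]) - G q\<bar> \<le> B / length q"
proof -
  obtain B where B: "\<forall>q. \<bar>G q\<bar> \<le> B \<and>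
     (\<forall>i<length q. \<forall>v. \<bar>G (q[i := v]) - G q\<bar> \<le> B / real (length q))"
    using assms unfolding slow_def by (elim exE)
  show ?thesis by (rule that[of B]) (use B in simp_all)
qed

lemma slow_const: "slow (\<lambda>_. a)"
  unfolding slow_def by (intro exI[of _ "\<bar>a\<bar>"]) simp

lemma slow_queue_fraction: "slow (queue_fraction k)"
  unfolding slow_def
  by (intro exI[of _ 1])
     (auto simp: queue_fraction_nonneg queue_fraction_le_1 queue_fraction_update of_bool_def)

lemma slow_add:
  assumes "slow G" "slow H" shows "slow (\<lambda>q. G q + H q)"
proof -
  obtain A where
    A: "\<And>q. \<bar>G q\<bar> \<le> A" "\<And>q i v. i < length q \<Longrightarrow> \<bar>G (q[i := v]) - G q\<bar> \<le> A / length q"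
    by (rule slowE[OF assms(1)]) (rule that)
  obtain B where
    B: "\<And>q. \<bar>H q\<bar> \<le> B" "\<And>q i v. i < length q \<Longrightarrow> \<bar>H (q[i := v]) - H q\<bar> \<le> B / length q"
    by (rule slowE[OF assms(2)]) (rule that)
  show ?thesis unfolding slow_def
  proof (intro exI[of _ "A + B"] conjI allI impI)
    show "\<bar>G q + H q\<bar> \<le> A + B" for q using A(1)[of q] B(1)[of q] by linarith
    show "\<bar>G (q[i := v]) + H (q[i := v]) - (G q + H q)\<bar> \<le> (A + B) / length q" if "i < length q" for q i v
      using A(2)[OF that, of v] B(2)[OF that, of v] by (simp add: add_divide_distrib)
  qed
qed

lemma slow_mult:
  assumes "slow G" "slow H" shows "slow (\<lambda>q. G q * H q)"
proof -
  obtain A where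
    A: "\<And>q. \<bar>G q\<bar> \<le> A" "\<And>q i v. i < length q \<Longrightarrow> \<bar>G (q[i := v]) - G q\<bar> \<le> A / length q"
    by (rule slowE[OF assms(1)]) (rule that)
  obtain B where
    B: "\<And>q. \<bar>H q\<bar> \<le> B" "\<And>q i v. i < length q \<Longrightarrow> \<bar>H (q[i := v]) - H q\<bar> \<le> B / length q"
    by (rule slowE[OF assms(2)]) (rule that)
  have A0: "A \<ge> 0" and B0: "B \<ge> 0" using A(1)[of "[]"] B(1)[of "[]"] by linarith+
  show ?thesis unfolding slow_def
  proof (intro exI[of _ "2 * A * B"] conjI allI impI)
    have "\<bar>G q * H q\<bar> \<le> A * B" for q
      unfolding abs_mult using A B A0 by (intro mult_mono) auto
    moreover have "A * B \<le> 2 * A * B" using A0 B0 by simp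
    ultimately show "\<bar>G q * H q\<bar> \<le> 2 * A * B" for q using order_trans by blast
    show "\<bar>G (q[i := v]) * H (q[i := v]) - G q * H q\<bar> \<le> 2 * A * B / length q" if "i < length q" for q i v
    proof -
      have "\<bar>G (q[i := v]) * H (q[i := v]) - G q * H q\<bar>
         = \<bar>G (q[i := v]) * (H (q[i := v]) - H q) + (G (q[i := v]) - G q) * H q\<bar>"
        by (simp add: algebra_simps)
      also have "\<dots> \<le> \<bar>G (q[i := v])\<bar> * \<bar>H (q[i := v]) - H q\<bar> + \<bar>G (q[i := v]) - G q\<bar> * \<bar>H q\<bar>"
        using abs_triangle_ineq by (metis abs_mult)
      also have "\<dots> \<le> A * (B / length q) + A / length q * B"
        using A(1) B(1) A(2)[OF that, of v] B(2)[OF that, of v] A0 by (intro add_mono mult_mono) auto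
      finally show ?thesis by (simp add: field_simps)
    qed
  qed
qed

lemma slow_diff: "slow G \<Longrightarrow> slow H \<Longrightarrow> slow (\<lambda>q. G q - H q)"
  using slow_add[of G "\<lambda>q. - 1 * H q"] slow_mult[OF slow_const[of "- 1"], of H] by simp

lemma slow_power: "slow G \<Longrightarrow> slow (\<lambda>q. G q ^ k)"
  by (induction k) (auto intro: slow_const slow_mult)

lemma slow_sum: "(\<And>i. i \<in> I \<Longrightarrow> slow (G i)) \<Longrightarrow> slow (\<lambda>q. \<Sum>i\<in>I. G i q)"
  by (induction I rule: infinite_finite_induct) (auto intro: slow_const slow_add)

lemma slow_lipschitz:
  assumes "slow G" and L: "\<And>q q'. \<bar>h (G q) - h (G q')\<bar> \<le> L * \<bar>G q - G q'\<bar>" and C: "\<And>q. \<bar>h (G q)\<bar> \<le> C"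
  shows "slow (\<lambda>q. h (G q))"
proof -
  obtain A where
    A: "\<And>q. \<bar>G q\<bar> \<le> A" "\<And>q i v. i < length q \<Longrightarrow> \<bar>G (q[i := v]) - G q\<bar> \<le> A / length q"
    by (rule slowE[OF assms(1)]) (rule that)
  have A0: "A \<ge> 0" using A(1)[of "[]"] by linarith
  show ?thesis unfolding slow_def
  proof (intro exI[of _ "max C (\<bar>L\<bar> * A)"] conjI allI impI)
    show "\<bar>h (G q)\<bar> \<le> max C (\<bar>L\<bar> * A)" for q using C[of q] by linarith
    show "\<bar>h (G (q[i := v])) - h (G q)\<bar> \<le> max C (\<bar>L\<bar> * A) / length q" if "i < length q" for q i v
    proof -
      have "\<bar>h (G (q[i := v])) - h (G q)\<bar> \<le> \<bar>L\<bar> * \<bar>G (q[i := v]) - G q\<bar>"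
        using L[of "q[i := v]" q] by (smt (verit) mult_right_mono abs_ge_zero)
      also have "\<dots> \<le> \<bar>L\<bar> * (A / length q)" using A(2)[OF that] by (intro mult_left_mono) auto
      also have "\<dots> \<le> max C (\<bar>L\<bar> * A) / length q"
        by (simp add: divide_right_mono)
      finally show ?thesis .
    qed
  qed
qed

text \<open>The number of tokens changes at rate \<open>O(n)\<close>, upwards at rate about \<open>\<mu> n (1 - s)\<close> with \<open>s\<close> the
  fraction of busy servers, and downwards at rate \<open>lam n\<close>. To leading order the generator therefore
  sees only the net flow across the level between \<open>j\<close> and \<open>j + 1\<close> tokens; the motion of \<open>G\<close> and
  the \<open>m \<le> c\<close> servers whose messages are discarded contribute \<open>O(1)\<close>.\<close>

lemma rcpb_gen_tokens:
  assumes S: "(q, m) \<in> rcpb_states n c" and n: "n > 0" and lam: "lam \<ge> 0" and mu: "\<mu> \<ge> 0"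
    and j: "Suc j \<le> c"
    and G: "\<And>q. \<bar>G q\<bar> \<le> B" "\<And>q i v. i < length q \<Longrightarrow> \<bar>G (q[i := v]) - G q\<bar> \<le> B / length q"
  shows "\<bar>rcpb_gen lam c \<mu> (\<lambda>(q, m). G q * of_bool (Suc j \<le> m)) (q, m)
     + real n * (G q * (lam * of_bool (m = Suc j) - \<mu> * (1 - queue_fraction 1 q) * of_bool (m = j)))\<bar>
     \<le> B * (lam + 1 + \<mu> * c)"
proof -
  let ?a = "arrival_rate lam q m" and ?g = "\<lambda>i v. G (q[i := v]) - G q"
  have q: "length q = n" and mc: "m \<le> c" using S by (auto simp: rcpb_states_def)
  have B0: "B \<ge> 0" using G(1)[of "[]"] by linarith
  have "(\<Sum>i<n. ?a i * (G (q[i := q ! i + 1]) * of_bool (Suc j \<le> m - 1) - G q * of_bool (Suc j \<le> m)))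
      = (\<Sum>i<n. ?a i * ?g i (q ! i + 1) * of_bool (Suc j \<le> m - 1) - ?a i * (G q * of_bool (m = Suc j)))"
    by (intro sum.cong) (auto simp: algebra_simps)
  also have "\<dots> = (\<Sum>i<n. ?a i * ?g i (q ! i + 1) * of_bool (Suc j \<le> m - 1))
       - real n * lam * (G q * of_bool (m = Suc j))"
    using sum_arrival_rate[OF S, of lam] q by (simp add: sum_subtractf sum_distrib_right[symmetric])
  finally have 1: "(\<Sum>i<n. ?a i * (G (q[i := q ! i + 1]) * of_bool (Suc j \<le> m - 1) - G q * of_bool (Suc j \<le> m)))
     = (\<Sum>i<n. ?a i * ?g i (q ! i + 1) * of_bool (Suc j \<le> m - 1)) - real n * lam * (G q * of_bool (m = Suc j))" .
  have 2: "(\<Sum>i<n. of_bool (q ! i > 0) * (G (q[i := q ! i - 1]) * of_bool (Suc j \<le> m) - G q * of_bool (Suc j \<le> m)))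
     = (\<Sum>i<n. of_bool (q ! i > 0) * ?g i (q ! i - 1) * of_bool (Suc j \<le> m))"
    by (intro sum.cong) (auto simp: algebra_simps)
  have 3: "\<mu> * (real (idle q) - real m) * of_bool (m < c) * (G q * of_bool (Suc j \<le> m + 1) - G q * of_bool (Suc j \<le> m))
     = real n * (G q * (\<mu> * (1 - queue_fraction 1 q) * of_bool (m = j))) - \<mu> * real m * G q * of_bool (m = j)"
    using j q by (auto simp: idle_queue_fraction algebra_simps of_bool_def)
  have b1: "\<bar>\<Sum>i<n. ?a i * ?g i (q ! i + 1) * of_bool (Suc j \<le> m - 1)\<bar> \<le> B * lam"
  proof -
    have "\<bar>?a i * ?g i (q ! i + 1) * of_bool (Suc j \<le> m - 1)\<bar> \<le> ?a i * (B / n)" if "i < n" for i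
    proof -
      have "\<bar>?g i (q ! i + 1)\<bar> * of_bool (Suc j \<le> m - 1) \<le> B / n"
        using G(2)[of i q "q ! i + 1"] q B0 that by (auto simp: of_bool_def)
      then have "?a i * (\<bar>?g i (q ! i + 1)\<bar> * of_bool (Suc j \<le> m - 1)) \<le> ?a i * (B / n)"
        by (intro mult_left_mono arrival_rate_nonneg lam)
      moreover have "\<bar>?a i * ?g i (q ! i + 1) * of_bool (Suc j \<le> m - 1)\<bar>
          = ?a i * (\<bar>?g i (q ! i + 1)\<bar> * of_bool (Suc j \<le> m - 1))"
        using arrival_rate_nonneg[OF lam, of q m i] by (simp add: abs_mult)
      ultimately show ?thesis by simp
    qed
    then have "\<bar>\<Sum>i<n. ?a i * ?g i (q ! i + 1) * of_bool (Suc j \<le> m - 1)\<bar> \<le> (\<Sum>i<n. ?a i * (B / n))"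
      by (intro order_trans[OF sum_abs] sum_mono) auto
    also have "\<dots> = B * lam"
      using sum_arrival_rate[OF S, of lam] q n by (simp only: sum_distrib_right[symmetric]) simp
    finally show ?thesis .
  qed
  have b2: "\<bar>\<Sum>i<n. of_bool (q ! i > 0) * ?g i (q ! i - 1) * of_bool (Suc j \<le> m)\<bar> \<le> B"
  proof -
    have "\<bar>\<Sum>i<n. of_bool (q ! i > 0) * ?g i (q ! i - 1) * of_bool (Suc j \<le> m)\<bar> \<le> (\<Sum>i<n. B / n)"
      using G(2)[of _ q] q B0
      by (intro order_trans[OF sum_abs] sum_mono) (auto simp: abs_mult of_bool_def)
    then show ?thesis using n by simp
  qed
  have b3: "\<bar>\<mu> * real m * G q * of_bool (m = j)\<bar> \<le> B * (\<mu> * c)"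
  proof -
    have "\<bar>\<mu> * real m * G q * of_bool (m = j)\<bar> = (\<mu> * real m) * \<bar>G q\<bar> * of_bool (m = j)"
      using mu by (simp add: abs_mult)
    also have "\<dots> \<le> (\<mu> * c) * B * 1"
      using mu mc G(1)[of q] B0 by (intro mult_mono) auto
    finally show ?thesis by (simp add: mult_ac)
  qed
  have "rcpb_gen lam c \<mu> (\<lambda>(q, m). G q * of_bool (Suc j \<le> m)) (q, m)
     + real n * (G q * (lam * of_bool (m = Suc j) - \<mu> * (1 - queue_fraction 1 q) * of_bool (m = j)))
     = (\<Sum>i<n. ?a i * ?g i (q ! i + 1) * of_bool (Suc j \<le> m - 1))
       + (\<Sum>i<n. of_bool (q ! i > 0) * ?g i (q ! i - 1) * of_bool (Suc j \<le> m))
       - \<mu> * real m * G q * of_bool (m = j)"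
    unfolding rcpb_gen_def prod.case q 1 2 3 by (simp add: algebra_simps)
  then show ?thesis using b1 b2 b3 by (simp add: algebra_simps)
qed

section \<open>A Lyapunov inequality for cooperative drifts\<close>

lemma mult_le_abs_mult:
  fixes x y b :: real
  assumes "\<bar>y\<bar> \<le> b" shows "x * y \<le> \<bar>x\<bar> * b"
proof -
  have "x * y \<le> \<bar>x\<bar> * \<bar>y\<bar>" by (simp add: abs_mult[symmetric])
  also have "\<dots> \<le> \<bar>x\<bar> * b" using assms by (intro mult_left_mono) auto
  finally show ?thesis .
qed

text \<open>\<open>clip \<epsilon>\<close> is the derivative of \<open>huber \<epsilon>\<close>, a smoothed absolute value. The absolute value itself
  is of no use here: jumps of size \<open>1 / n\<close> at rate \<open>n\<close> across its kink have an effect of order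
  \<open>1\<close>, whereas for fixed \<open>\<epsilon>\<close> the smoothing makes it \<open>O(1 / n)\<close>.\<close>

definition clip :: "real \<Rightarrow> real \<Rightarrow> real" where
  "clip \<epsilon> u = max (- 1) (min 1 (u / \<epsilon>))"

definition huber :: "real \<Rightarrow> real \<Rightarrow> real" where
  "huber \<epsilon> u = u * clip \<epsilon> u - \<epsilon> / 2 * (clip \<epsilon> u)\<^sup>2"

lemma abs_clip_le_1: "\<bar>clip \<epsilon> u\<bar> \<le> 1"
  by (auto simp: clip_def)

lemma clip_lipschitz:
  assumes "\<epsilon> > 0" shows "\<bar>clip \<epsilon> u - clip \<epsilon> v\<bar> \<le> 1 / \<epsilon> * \<bar>u - v\<bar>"
proof -
  have "\<bar>clip \<epsilon> u - clip \<epsilon> v\<bar> \<le> \<bar>u / \<epsilon> - v / \<epsilon>\<bar>" by (auto simp: clip_def)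
  then show ?thesis using assms by (simp add: diff_divide_distrib[symmetric] abs_divide)
qed

lemma clip_nonneg_iff: "\<epsilon> > 0 \<Longrightarrow> clip \<epsilon> u \<ge> 0 \<longleftrightarrow> u \<ge> 0"
  by (simp add: clip_def zero_le_divide_iff le_max_iff_disj)

lemma mult_clip:
  assumes "\<epsilon> > 0" shows "u * clip \<epsilon> u = \<bar>u\<bar> * \<bar>clip \<epsilon> u\<bar>"
proof (cases "u \<ge> 0")
  case True
  then show ?thesis using clip_nonneg_iff[OF assms, of u] by simp
next
  case False
  then show ?thesis using clip_nonneg_iff[OF assms, of u] by (simp add: abs_of_neg)
qed

lemma abs_mult_one_minus_clip:
  assumes "\<epsilon> > 0" shows "\<bar>u\<bar> * (1 - \<bar>clip \<epsilon> u\<bar>) \<le> \<epsilon>"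
proof (cases "\<bar>u\<bar> \<le> \<epsilon>")
  case True
  have "\<bar>u\<bar> * (1 - \<bar>clip \<epsilon> u\<bar>) \<le> \<epsilon> * 1"
    using True abs_clip_le_1[of \<epsilon> u] assms by (intro mult_mono) auto
  then show ?thesis by simp
next
  case False
  then have "u / \<epsilon> \<ge> 1 \<or> u / \<epsilon> \<le> - 1" using assms by (auto simp: field_simps abs_if split: if_splits)
  then have "\<bar>clip \<epsilon> u\<bar> = 1" by (auto simp: clip_def)
  then show ?thesis using assms by simp
qed

lemma mult_clip_diff_le:
  assumes "\<epsilon> > 0" "\<bar>y\<bar> \<le> 1" shows "u * (y - clip \<epsilon> u) \<le> \<epsilon>"
proof -
  have "u * y \<le> \<bar>u\<bar> * 1"
    using assms(2) by (rule mult_le_abs_mult)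
  then have "u * (y - clip \<epsilon> u) \<le> \<bar>u\<bar> * (1 - \<bar>clip \<epsilon> u\<bar>)"
    using mult_clip[OF assms(1), of u] by (simp add: algebra_simps)
  then show ?thesis using abs_mult_one_minus_clip[OF assms(1), of u] by linarith
qed

text \<open>\<open>huber \<epsilon> u\<close> is the maximum of \<open>u * w - \<epsilon> / 2 * w\<^sup>2\<close> over \<open>\<bar>w\<bar> \<le> 1\<close> (a Legendre transform),
  attained at \<open>clip \<epsilon> u\<close>, the point of \<open>[-1, 1]\<close> closest to \<open>u / \<epsilon>\<close>.\<close>

lemma huber_ge:
  assumes e: "\<epsilon> > 0" and w: "\<bar>w\<bar> \<le> 1"
  shows "u * w - \<epsilon> / 2 * w\<^sup>2 \<le> huber \<epsilon> u"
proof -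
  have "\<bar>clip \<epsilon> u - u / \<epsilon>\<bar> \<le> \<bar>w - u / \<epsilon>\<bar>" using w by (auto simp: clip_def)
  then have "(clip \<epsilon> u - u / \<epsilon>)\<^sup>2 \<le> (w - u / \<epsilon>)\<^sup>2" by (simp add: abs_le_square_iff)
  then have "\<epsilon> / 2 * (clip \<epsilon> u - u / \<epsilon>)\<^sup>2 \<le> \<epsilon> / 2 * (w - u / \<epsilon>)\<^sup>2" using e by simp
  moreover have sq: "\<epsilon> / 2 * (z - u / \<epsilon>)\<^sup>2 = \<epsilon> / 2 * z\<^sup>2 - u * z + u\<^sup>2 / (2 * \<epsilon>)" for z
    using e by (simp add: power2_eq_square field_simps)
  ultimately show ?thesis unfolding huber_def by (simp only: sq)
qed

lemma huber_step_le:
  assumes e: "\<epsilon> > 0"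
  shows "huber \<epsilon> (u + h) - huber \<epsilon> u \<le> h * clip \<epsilon> u + h\<^sup>2 / \<epsilon>"
proof -
  have "huber \<epsilon> (u + h) - huber \<epsilon> u \<le> h * clip \<epsilon> (u + h)"
    using huber_ge[OF e abs_clip_le_1, of u \<epsilon> "u + h"]
    by (simp add: huber_def algebra_simps)
  also have "\<dots> = h * clip \<epsilon> u + h * (clip \<epsilon> (u + h) - clip \<epsilon> u)" by (simp add: algebra_simps)
  also have "h * (clip \<epsilon> (u + h) - clip \<epsilon> u) \<le> \<bar>h\<bar> * (1 / \<epsilon> * \<bar>h\<bar>)"
    using clip_lipschitz[OF e, of "u + h" u] by (intro mult_le_abs_mult) simp
  also have "\<dots> = h\<^sup>2 / \<epsilon>" by (simp add: power2_eq_square)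
  finally show ?thesis by simp
qed

lemma summation_by_parts_flux:
  fixes U d y b :: "nat \<Rightarrow> real"
  assumes b0: "b 0 = - U 0 - d 0 + d 1"
    and bS: "\<And>k. b (Suc k) = U k - U (Suc k) - d (Suc k) + d (Suc (Suc k))"
  shows "(\<Sum>k\<le>K. y k * b k) = - (d 0 * y 0)
     + (\<Sum>k<K. U k * (y (Suc k) - y k) + d (Suc k) * (y k - y (Suc k)))
     - U K * y K + d (Suc K) * y K"
  by (induction K) (simp_all add: b0 bS algebra_simps)

text \<open>The \<open>\<ell>\<^sup>1\<close> contraction of a cooperative system. Here \<open>U k - d (Suc k)\<close> is the net flux from level
  \<open>k\<close> to level \<open>k + 1\<close>, relative to equilibrium. After summation by parts each term pairs \<open>d k\<close> with
  the difference of \<open>clip\<close> at a neighbouring level and at \<open>d k\<close> itself, which costs at most \<open>\<epsilon>\<close>.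
  What survives is the outflow \<open>- \<bar>d 0\<bar>\<close> at the bottom and the boundary term at the
  truncation level. The feedback \<open>\<delta>\<close>, which has the sign of \<open>d 0\<close>, does not spoil this: its
  effect on all higher levels together is at most \<open>l * \<bar>\<delta>\<bar> * e 0\<close>, because \<open>e\<close> is
  decreasing, and its effect at the bottom cancels that up to a multiple of \<open>\<epsilon>\<close>.\<close>

lemma drift_inequality:
  fixes d e b U :: "nat \<Rightarrow> real"
  assumes eps: "\<epsilon> > 0"
    and b0: "b 0 = - U 0 - d 0 + d 1"
    and bS: "\<And>k. b (Suc k) = U k - U (Suc k) - d (Suc k) + d (Suc (Suc k))"
    and U: "\<And>k. U k = l * (p * d k + \<delta> * e k)"
    and l: "0 \<le> l" "l \<le> 1" and p: "0 \<le> p" "p \<le> 1"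
    and e: "\<And>k. 0 \<le> e k" "\<And>k. e (Suc k) \<le> e k" "e 0 \<le> 1"
    and \<delta>: "\<delta> * d 0 \<ge> 0" "\<bar>\<delta>\<bar> \<le> L * \<bar>d 0\<bar>" and L: "L \<ge> 0"
  shows "(\<Sum>k\<le>K. clip \<epsilon> (d k) * b k) \<le> - \<bar>d 0\<bar> + \<bar>d (Suc K)\<bar> + (1 + 2 * real K + L) * \<epsilon>"
proof -
  define y where "y k = clip \<epsilon> (d k)" for k
  have y1: "\<bar>y k\<bar> \<le> 1" for k by (simp add: y_def abs_clip_le_1)
  have lp: "0 \<le> l * p" "l * p \<le> 1" using l p by (auto simp: mult_le_one)
  have up: "l * p * (d k * (y j - y k)) \<le> \<epsilon>" for j k
  proof -
    have "l * p * (d k * (y j - y k)) \<le> l * p * \<epsilon>"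
      using mult_clip_diff_le[OF eps y1, of "d k"] lp by (intro mult_left_mono) (simp_all add: y_def)
    also have "\<dots> \<le> 1 * \<epsilon>" using lp eps by (intro mult_right_mono) auto
    finally show ?thesis by simp
  qed
  \<comment> \<open>the feedback telescopes against the decreasing profile\<close>
  have parts: "(\<Sum>k<K. e k * (y (Suc k) - y k)) - e K * y K
      = - (e 0 * y 0) + (\<Sum>k<K. (e k - e (Suc k)) * y (Suc k))" for K
    by (induction K) (simp_all add: algebra_simps)
  have tel: "(\<Sum>k<K. e k - e (Suc k)) = e 0 - e K"
    by (induction K) simp_all
  have "\<bar>\<Sum>k<K. (e k - e (Suc k)) * y (Suc k)\<bar> \<le> (\<Sum>k<K. e k - e (Suc k))"
  proof (rule order_trans[OF sum_abs], rule sum_mono)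
    fix k
    have "\<bar>e k - e (Suc k)\<bar> * \<bar>y (Suc k)\<bar> \<le> \<bar>e k - e (Suc k)\<bar> * 1"
      using y1 by (intro mult_left_mono) auto
    then show "\<bar>(e k - e (Suc k)) * y (Suc k)\<bar> \<le> e k - e (Suc k)"
      using e(2)[of k] by (simp add: abs_mult)
  qed
  then have tail: "\<bar>\<Sum>k<K. (e k - e (Suc k)) * y (Suc k)\<bar> \<le> e 0"
    using e(1)[of K] by (simp add: tel)
  have dy: "\<delta> * y 0 = \<bar>\<delta>\<bar> * \<bar>y 0\<bar>"
  proof (cases "d 0 = 0")
    case True
    then show ?thesis using \<delta>(2) by simp
  next
    case False
    have "\<delta> * y 0 \<ge> 0"
      using \<delta>(1) False clip_nonneg_iff[OF eps, of "d 0"] unfolding y_def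
      by (auto simp: zero_le_mult_iff)
    then show ?thesis by (simp add: abs_mult[symmetric])
  qed
  have "\<delta> * ((\<Sum>k<K. e k * (y (Suc k) - y k)) - e K * y K)
      = - (e 0 * (\<bar>\<delta>\<bar> * \<bar>y 0\<bar>)) + \<delta> * (\<Sum>k<K. (e k - e (Suc k)) * y (Suc k))"
    unfolding parts dy[symmetric] by (simp add: algebra_simps)
  also have "\<dots> \<le> - (e 0 * (\<bar>\<delta>\<bar> * \<bar>y 0\<bar>)) + \<bar>\<delta>\<bar> * e 0"
    using tail by (intro add_left_mono mult_le_abs_mult)
  also have "\<dots> = e 0 * (\<bar>\<delta>\<bar> * (1 - \<bar>y 0\<bar>))" by (simp add: algebra_simps)
  also have "\<dots> \<le> 1 * (L * \<epsilon>)"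
  proof (rule mult_mono)
    have "\<bar>\<delta>\<bar> * (1 - \<bar>y 0\<bar>) \<le> L * \<bar>d 0\<bar> * (1 - \<bar>y 0\<bar>)"
      using \<delta>(2) y1[of 0] by (intro mult_right_mono) auto
    also have "\<dots> = L * (\<bar>d 0\<bar> * (1 - \<bar>y 0\<bar>))" by simp
    also have "\<dots> \<le> L * \<epsilon>"
      using abs_mult_one_minus_clip[OF eps, of "d 0"] L unfolding y_def by (intro mult_left_mono)
    finally show "\<bar>\<delta>\<bar> * (1 - \<bar>y 0\<bar>) \<le> L * \<epsilon>" .
  qed (use e(3) y1 in auto)
  finally have "l * (\<delta> * ((\<Sum>k<K. e k * (y (Suc k) - y k)) - e K * y K)) \<le> l * (L * \<epsilon>)"
    using l by (simp add: mult_left_mono)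
  also have "\<dots> \<le> 1 * (L * \<epsilon>)" using l L eps by (intro mult_right_mono) auto
  finally have R: "l * (\<delta> * ((\<Sum>k<K. e k * (y (Suc k) - y k)) - e K * y K)) \<le> L * \<epsilon>" by simp
  have "(\<Sum>k\<le>K. y k * b k) = - (d 0 * y 0)
     + (\<Sum>k<K. U k * (y (Suc k) - y k) + d (Suc k) * (y k - y (Suc k)))
     - U K * y K + d (Suc K) * y K"
    by (rule summation_by_parts_flux[OF b0 bS])
  also have "\<dots> = - (d 0 * y 0)
     + (\<Sum>k<K. l * p * (d k * (y (Suc k) - y k)) + d (Suc k) * (y k - y (Suc k)))
     + l * (\<delta> * ((\<Sum>k<K. e k * (y (Suc k) - y k)) - e K * y K))
     - l * p * (d K * y K) + d (Suc K) * y K"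
    unfolding U by (simp add: algebra_simps sum.distrib sum_subtractf sum_distrib_left)
  also have "\<dots> \<le> (- \<bar>d 0\<bar> + \<epsilon>) + (\<Sum>k<K. \<epsilon> + \<epsilon>) + L * \<epsilon> - 0 + \<bar>d (Suc K)\<bar>"
  proof (intro add_mono diff_mono sum_mono)
    show "- (d 0 * y 0) \<le> - \<bar>d 0\<bar> + \<epsilon>"
      using abs_mult_one_minus_clip[OF eps, of "d 0"] mult_clip[OF eps, of "d 0"]
      by (simp add: y_def algebra_simps)
    show "l * p * (d k * (y (Suc k) - y k)) \<le> \<epsilon>" for k by (rule up)
    show "d (Suc k) * (y k - y (Suc k)) \<le> \<epsilon>" for k
      using mult_clip_diff_le[OF eps y1, of "d (Suc k)"] by (simp add: y_def)
    show "0 \<le> l * p * (d K * y K)"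
      using mult_clip[OF eps, of "d K"] lp by (simp add: y_def)
    show "d (Suc K) * y K \<le> \<bar>d (Suc K)\<bar>"
      using mult_le_abs_mult[OF y1[of K], of "d (Suc K)"] by simp
  qed (rule R)
  also have "\<dots> = - \<bar>d 0\<bar> + \<bar>d (Suc K)\<bar> + (1 + 2 * real K + L) * \<epsilon>" by (simp add: algebra_simps)
  finally show ?thesis by (simp add: y_def)
qed

section \<open>The equilibrium of the token chain\<close>

text \<open>The probability of \<open>0\<close> in the stationary law of the birth-death chain on \<open>{0..c}\<close> whose birth and
  death rates have the ratio \<open>\<rho> * (1 - u)\<close>.\<close>

definition empty_prob :: "real \<Rightarrow> nat \<Rightarrow> real \<Rightarrow> real" where
  "empty_prob \<rho> c u = inverse (\<Sum>j\<le>c. (\<rho> * (1 - u)) ^ j)"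

lemma empty_prob_denominator_ge_1:
  assumes "\<rho> \<ge> 0" "u \<le> 1" shows "(\<Sum>j\<le>c. (\<rho> * (1 - u)) ^ j) \<ge> (1::real)"
proof -
  have "(\<Sum>j\<in>{0}. (\<rho> * (1 - u)) ^ j) \<le> (\<Sum>j\<le>c. (\<rho> * (1 - u)) ^ j)"
    using assms by (intro sum_mono2) auto
  then show ?thesis by simp
qed

lemma empty_prob_pos: "\<rho> \<ge> 0 \<Longrightarrow> u \<le> 1 \<Longrightarrow> 0 < empty_prob \<rho> c u"
  and empty_prob_le_1: "\<rho> \<ge> 0 \<Longrightarrow> u \<le> 1 \<Longrightarrow> empty_prob \<rho> c u \<le> 1"
  using empty_prob_denominator_ge_1[of \<rho> u c] by (auto simp: empty_prob_def inverse_le_1_iff)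

lemma empty_prob_mono:
  assumes "\<rho> \<ge> 0" "u \<le> v" "v \<le> 1" shows "empty_prob \<rho> c u \<le> empty_prob \<rho> c v"
  unfolding empty_prob_def
proof (rule le_imp_inverse_le)
  show "(\<Sum>j\<le>c. (\<rho> * (1 - v)) ^ j) \<le> (\<Sum>j\<le>c. (\<rho> * (1 - u)) ^ j)"
    using assms by (intro sum_mono power_mono mult_left_mono) auto
  show "0 < (\<Sum>j\<le>c. (\<rho> * (1 - v)) ^ j)"
    using empty_prob_denominator_ge_1[of \<rho> v c] assms by linarith
qed

lemma abs_inverse_diff_le:
  fixes a b :: real
  assumes "a \<ge> 1" "b \<ge> 1" shows "\<bar>inverse a - inverse b\<bar> \<le> \<bar>a - b\<bar>"
proof -
  have "inverse a - inverse b = (b - a) / (a * b)" using assms by (simp add: field_simps)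
  then have "\<bar>inverse a - inverse b\<bar> = \<bar>a - b\<bar> / (a * b)" using assms by (simp add: abs_mult)
  also have "\<dots> \<le> \<bar>a - b\<bar> / 1"
    using assms mult_mono[of 1 a 1 b] by (intro divide_left_mono) auto
  finally show ?thesis by simp
qed

lemma empty_prob_lipschitz:
  assumes r: "\<rho> \<ge> 0" and u: "0 \<le> u" "u \<le> 1" and v: "0 \<le> v" "v \<le> 1"
  shows "\<bar>empty_prob \<rho> c u - empty_prob \<rho> c v\<bar> \<le> (\<Sum>j\<le>c. \<rho> ^ j * real j) * \<bar>u - v\<bar>"
proof -
  have "\<bar>empty_prob \<rho> c u - empty_prob \<rho> c v\<bar>
      \<le> \<bar>(\<Sum>j\<le>c. (\<rho> * (1 - u)) ^ j) - (\<Sum>j\<le>c. (\<rho> * (1 - v)) ^ j)\<bar>"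
    unfolding empty_prob_def using assms by (intro abs_inverse_diff_le empty_prob_denominator_ge_1)
  also have "\<dots> = \<bar>\<Sum>j\<le>c. \<rho> ^ j * ((1 - u) ^ j - (1 - v) ^ j)\<bar>"
    by (simp only: power_mult_distrib sum_subtractf[symmetric] right_diff_distrib[of "\<rho> ^ _"])
  also have "\<dots> \<le> (\<Sum>j\<le>c. \<rho> ^ j * (real j * \<bar>u - v\<bar>))"
  proof (rule order_trans[OF sum_abs], rule sum_mono)
    fix j
    have "\<bar>(1 - u) ^ j - (1 - v) ^ j\<bar> \<le> real j * \<bar>u - v\<bar>"
      using norm_power_diff[of "1 - u" "1 - v" j] u v by (simp add: abs_minus_commute)
    then show "\<bar>\<rho> ^ j * ((1 - u) ^ j - (1 - v) ^ j)\<bar> \<le> \<rho> ^ j * (real j * \<bar>u - v\<bar>)"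
      using r by (simp add: abs_mult mult_left_mono)
  qed
  finally show ?thesis by (simp add: sum_distrib_right mult.assoc)
qed

lemma slow_empty_prob:
  assumes "\<rho> \<ge> 0" shows "slow (\<lambda>q. empty_prob \<rho> c (queue_fraction 1 q))"
  unfolding empty_prob_def
proof (rule slow_lipschitz[where h = inverse and G = "\<lambda>q. \<Sum>j\<le>c. (\<rho> * (1 - queue_fraction 1 q)) ^ j"])
  show "slow (\<lambda>q. \<Sum>j\<le>c. (\<rho> * (1 - queue_fraction 1 q)) ^ j)"
    by (intro slow_sum slow_power slow_mult slow_diff slow_const slow_queue_fraction)
  show "\<bar>inverse (\<Sum>j\<le>c. (\<rho> * (1 - queue_fraction 1 q)) ^ j) -
          inverse (\<Sum>j\<le>c. (\<rho> * (1 - queue_fraction 1 q')) ^ j)\<bar>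
        \<le> 1 * \<bar>(\<Sum>j\<le>c. (\<rho> * (1 - queue_fraction 1 q)) ^ j) -
          (\<Sum>j\<le>c. (\<rho> * (1 - queue_fraction 1 q')) ^ j)\<bar>" for q q'
    using abs_inverse_diff_le[OF empty_prob_denominator_ge_1 empty_prob_denominator_ge_1,
        of \<rho> "queue_fraction 1 q" \<rho> "queue_fraction 1 q'" c c] assms
    by (simp add: queue_fraction_le_1)
  show "\<bar>inverse (\<Sum>j\<le>c. (\<rho> * (1 - queue_fraction 1 q)) ^ j)\<bar> \<le> 1" for q
    using empty_prob_pos[of \<rho> "queue_fraction 1 q" c] empty_prob_le_1[of \<rho> "queue_fraction 1 q" c] assms
    by (simp add: queue_fraction_le_1 empty_prob_def)
qed

lemma slow_clip:
  assumes "\<epsilon> > 0" "slow G" shows "slow (\<lambda>q. clip \<epsilon> (G q))"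
  by (rule slow_lipschitz[where h = "clip \<epsilon>", OF assms(2)], rule clip_lipschitz[OF assms(1)], rule abs_clip_le_1)

lemma slow_huber:
  assumes "\<epsilon> > 0" "slow G" shows "slow (\<lambda>q. huber \<epsilon> (G q))"
  unfolding huber_def power2_eq_square
  by (intro slow_diff slow_mult slow_const slow_clip assms)

section \<open>Flow balance and token averaging in the stationary regime\<close>

text \<open>All test functions and integrands are bounded on the whole state type, so integrability under
  every law is a matter of syntax.\<close>

definition bdd :: "(rcpb_state \<Rightarrow> real) \<Rightarrow> bool" where
  "bdd f \<longleftrightarrow> (\<exists>B. \<forall>x. \<bar>f x\<bar> \<le> B)"

lemma bddI: "(\<And>x. \<bar>f x\<bar> \<le> B) \<Longrightarrow> bdd f"
  unfolding bdd_def by (intro exI allI)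

lemma bddE:
  assumes "bdd f" obtains B where "\<And>x. \<bar>f x\<bar> \<le> B"
  using assms unfolding bdd_def by auto

lemma bdd_const: "bdd (\<lambda>_. a)"
  by (rule bddI[of _ "\<bar>a\<bar>"]) simp

lemma bdd_of_bool: "bdd (\<lambda>x. of_bool (R x))"
  by (rule bddI[of _ 1]) simp

lemma bdd_slow:
  assumes "slow G" shows "bdd (\<lambda>x. G (fst x))"
  by (rule slowE[OF assms]) (rule bddI)

lemma bdd_add:
  assumes "bdd f" "bdd g" shows "bdd (\<lambda>x. f x + g x)"
proof -
  obtain A where A: "\<And>x. \<bar>f x\<bar> \<le> A" by (rule bddE[OF assms(1)]) (rule that)
  obtain B where B: "\<And>x. \<bar>g x\<bar> \<le> B" by (rule bddE[OF assms(2)]) (rule that)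
  show ?thesis
  proof (rule bddI)
    show "\<bar>f x + g x\<bar> \<le> A + B" for x using A[of x] B[of x] by linarith
  qed
qed

lemma bdd_mult:
  assumes "bdd f" "bdd g" shows "bdd (\<lambda>x. f x * g x)"
proof -
  obtain A where A: "\<And>x. \<bar>f x\<bar> \<le> A" by (rule bddE[OF assms(1)]) (rule that)
  obtain B where B: "\<And>x. \<bar>g x\<bar> \<le> B" by (rule bddE[OF assms(2)]) (rule that)
  have "A \<ge> 0" using A[of undefined] by linarith
  show ?thesis
  proof (rule bddI)
    show "\<bar>f x * g x\<bar> \<le> A * B" for x unfolding abs_mult by (intro mult_mono A B) (use \<open>A \<ge> 0\<close> in auto)
  qed
qed

lemma bdd_diff: "bdd f \<Longrightarrow> bdd g \<Longrightarrow> bdd (\<lambda>x. f x - g x)"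
  using bdd_add[of f "\<lambda>x. - 1 * g x"] bdd_mult[OF bdd_const[of "- 1"], of g] by simp

lemma bdd_abs: "bdd f \<Longrightarrow> bdd (\<lambda>x. \<bar>f x\<bar>)"
  unfolding bdd_def by simp

lemma bdd_sum: "(\<And>i. i \<in> I \<Longrightarrow> bdd (f i)) \<Longrightarrow> bdd (\<lambda>x. \<Sum>i\<in>I. f i x)"
  by (induction I rule: infinite_finite_induct) (auto intro: bdd_const bdd_add)

lemmas bdd_intros = bdd_const bdd_of_bool bdd_slow bdd_add bdd_mult bdd_diff bdd_abs bdd_sum
  slow_const slow_queue_fraction slow_add slow_mult slow_diff slow_power slow_sum

lemma integrable_bdd:
  assumes "bdd f" shows "integrable (measure_pmf p) f"
proof -
  obtain A where A: "\<And>x. \<bar>f x\<bar> \<le> A" by (rule bddE[OF assms]) (rule that)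
  then show ?thesis by (intro measure_pmf.integrable_const_bound[where B = A]) auto
qed

text \<open>Of the semigroup only the generator identity and the support of the stationary laws are kept. They
  determine the asymptotic delay.\<close>

locale rcpb_stationary =
  fixes lam \<mu> :: real and c :: nat and \<pi> :: "nat \<Rightarrow> rcpb_state pmf"
  assumes lam: "0 < lam" "lam < 1" and mu: "\<mu> > 0" and c: "c \<ge> 1"
    and supp: "\<And>n. n \<ge> c \<Longrightarrow> set_pmf (\<pi> n) \<subseteq> rcpb_states n c"
    and gen: "\<And>n f B. n \<ge> c \<Longrightarrow> (\<And>x. \<bar>f x\<bar> \<le> B) \<Longrightarrow>
       measure_pmf.expectation (\<pi> n) (rcpb_gen lam c \<mu> f) = 0"
begin

abbreviation E :: "nat \<Rightarrow> (rcpb_state \<Rightarrow> real) \<Rightarrow> real" where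
  "E n f \<equiv> measure_pmf.expectation (\<pi> n) f"

abbreviation s :: "nat \<Rightarrow> rcpb_state \<Rightarrow> real" where
  "s k x \<equiv> queue_fraction k (fst x)"

abbreviation Z :: "rcpb_state \<Rightarrow> real" where
  "Z x \<equiv> of_bool (snd x = 0)"

lemma E_cong:
  assumes "n \<ge> c" "\<And>x. x \<in> rcpb_states n c \<Longrightarrow> f x = g x"
  shows "E n f = E n g"
  using supp[OF assms(1)] assms(2) by (intro integral_cong_AE) (auto simp: AE_measure_pmf_iff)

lemma E_mono:
  assumes "n \<ge> c" "bdd f" "bdd g" "\<And>x. x \<in> rcpb_states n c \<Longrightarrow> f x \<le> g x"
  shows "E n f \<le> E n g"
  using supp[OF assms(1)] assms(4)
  by (intro integral_mono_AE integrable_bdd assms) (auto simp: AE_measure_pmf_iff)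

lemma E_add: "bdd f \<Longrightarrow> bdd g \<Longrightarrow> E n (\<lambda>x. f x + g x) = E n f + E n g"
  by (intro Bochner_Integration.integral_add integrable_bdd)

lemma E_diff: "bdd f \<Longrightarrow> bdd g \<Longrightarrow> E n (\<lambda>x. f x - g x) = E n f - E n g"
  by (intro Bochner_Integration.integral_diff integrable_bdd)

lemma E_sum: "(\<And>i. i \<in> I \<Longrightarrow> bdd (f i)) \<Longrightarrow> E n (\<lambda>x. \<Sum>i\<in>I. f i x) = (\<Sum>i\<in>I. E n (f i))"
  by (intro Bochner_Integration.integral_sum integrable_bdd)

lemma abs_E_le: "bdd f \<Longrightarrow> \<bar>E n f\<bar> \<le> E n (\<lambda>x. \<bar>f x\<bar>)"
  by (rule integral_abs_bound)

text \<open>The rate of upward jumps of \<open>s (Suc k)\<close>, divided by \<open>n\<close>. For \<open>k = 0\<close> it uses \<open>s 0 = 1\<close>, so that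
  both cases depend on the tokens through \<open>Z\<close> times a slow observable.\<close>

definition up :: "nat \<Rightarrow> rcpb_state \<Rightarrow> real" where
  "up k x = lam * (of_bool (k = 0) + Z x * (of_bool (k \<noteq> 0) * s k x - s (Suc k) x))"

lemma bdd_up: "bdd (up k)"
  unfolding up_def by (intro bdd_intros)

lemma length_states: "n \<ge> c \<Longrightarrow> x \<in> rcpb_states n c \<Longrightarrow> length (fst x) = n \<and> n > 0 \<and> fst x \<noteq> []"
  using c by (auto simp: rcpb_states_def)

lemma gen_queue_fraction:
  assumes n: "n \<ge> c" and x: "x \<in> rcpb_states n c"
  shows "rcpb_gen lam c \<mu> (\<lambda>x. h (s (Suc k) x)) x =
     real n * up k x * (h (s (Suc k) x + 1 / n) - h (s (Suc k) x))
     + real n * (s (Suc k) x - s (Suc (Suc k)) x) * (h (s (Suc k) x - 1 / n) - h (s (Suc k) x))"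
proof -
  obtain q m where x': "x = (q, m)" by fastforce
  have "up k x = (if m = 0 then lam * (queue_fraction k q - queue_fraction (Suc k) q) else lam * of_bool (k = 0))"
    using length_states[OF n x] by (auto simp: up_def x' queue_fraction_0)
  then show ?thesis
    using rcpb_gen_queue_fraction[of q m n c lam \<mu> h k] x length_states[OF n x]
    by (simp add: x' case_prod_beta')
qed

lemma up_bounds:
  assumes n: "n \<ge> c" and x: "x \<in> rcpb_states n c" shows "0 \<le> up k x" "up k x \<le> 1"
proof -
  have *: "0 \<le> of_bool (k = 0) + Z x * (of_bool (k \<noteq> 0) * s k x - s (Suc k) x)"
      "of_bool (k = 0) + Z x * (of_bool (k \<noteq> 0) * s k x - s (Suc k) x) \<le> 1"
    using queue_fraction_nonneg[of "Suc k" "fst x"] queue_fraction_le_1[of k "fst x"]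
      queue_fraction_le_1[of "Suc k" "fst x"]
      queue_fraction_antimono[of k "Suc k" "fst x"] by (auto simp: of_bool_def)
  then show "0 \<le> up k x" using lam unfolding up_def by (intro mult_nonneg_nonneg) auto
  show "up k x \<le> 1" using lam * unfolding up_def by (intro mult_le_one) auto
qed

lemma E_up:
  assumes n: "n \<ge> c" shows "E n (up k) = E n (s (Suc k)) - E n (s (Suc (Suc k)))"
proof -
  have "0 = E n (rcpb_gen lam c \<mu> (s (Suc k)))"
    by (subst gen[OF n, where B = 1]) (auto simp: queue_fraction_nonneg queue_fraction_le_1)
  also have "\<dots> = E n (\<lambda>x. up k x - (s (Suc k) x - s (Suc (Suc k)) x))"
  proof (rule E_cong[OF n])
    fix x assume x: "x \<in> rcpb_states n c"
    then have "n > 0" using length_states[OF n] by blast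
    then show "rcpb_gen lam c \<mu> (s (Suc k)) x = up k x - (s (Suc k) x - s (Suc (Suc k)) x)"
      unfolding gen_queue_fraction[OF n x, of "\<lambda>x. x" k] by simp
  qed
  also have "\<dots> = E n (up k) - (E n (s (Suc k)) - E n (s (Suc (Suc k))))"
    by (subst E_diff, intro bdd_up, intro bdd_intros, subst E_diff) (intro bdd_intros refl)+
  finally show ?thesis by simp
qed

definition mean_tail :: "nat \<Rightarrow> nat \<Rightarrow> real" where "mean_tail n k = E n (s k)"
definition mean_tail_no_token :: "nat \<Rightarrow> nat \<Rightarrow> real" where "mean_tail_no_token n k = E n (\<lambda>x. Z x * s k x)"

lemma mean_tail_nonneg: "mean_tail n k \<ge> 0"
  unfolding mean_tail_def by (intro Bochner_Integration.integral_nonneg) (auto simp: queue_fraction_nonneg)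

lemma mean_tail_no_token_nonneg: "mean_tail_no_token n k \<ge> 0" and mean_tail_no_token_le: "mean_tail_no_token n k \<le> mean_tail n k"
proof -
  show "mean_tail_no_token n k \<ge> 0" unfolding mean_tail_no_token_def by (intro Bochner_Integration.integral_nonneg) (auto simp: queue_fraction_nonneg)
  show "mean_tail_no_token n k \<le> mean_tail n k" unfolding mean_tail_no_token_def mean_tail_def
    by (intro integral_mono integrable_bdd bdd_intros) (auto simp: queue_fraction_nonneg of_bool_def)
qed

lemma mean_tail_tendsto_0: "(\<lambda>k. mean_tail n k) \<longlonglongrightarrow> 0"
proof -
  have lim: "(\<lambda>k. s k x) \<longlonglongrightarrow> 0" for x
  proof (rule tendsto_eventually, rule eventually_sequentiallyI)
    fix k assume k: "k \<ge> Suc (sum_list (fst x))"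
    have "\<not> k \<le> fst x ! j" if "j < length (fst x)" for j
      using elem_le_sum_list[OF that] k by linarith
    then have "{j. j < length (fst x) \<and> k \<le> fst x ! j} = {}" by blast
    then show "s k x = 0" by (simp add: queue_fraction_def)
  qed
  have "(\<lambda>k. E n (s k)) \<longlonglongrightarrow> E n (\<lambda>_. 0)"
    by (rule integral_dominated_convergence[where w = "\<lambda>_. 1"])
       (auto simp: lim queue_fraction_nonneg queue_fraction_le_1)
  then show ?thesis by (simp add: mean_tail_def)
qed

text \<open>The balance equations of the levels say that the difference of the two sides of the second
  equation is the same for all \<open>k\<close>, and equal to \<open>lam - mean_tail n 1\<close>. It vanishes because
  tails tend to \<open>0\<close>, which replaces any moment bound on the queue lengths.\<close>

lemma flow_balance:
  assumes n: "n \<ge> c" shows "mean_tail n 1 = lam" and "mean_tail n (Suc (Suc k)) = lam * mean_tail_no_token n (Suc k)"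
proof -
  have up0: "E n (up 0) = lam - lam * mean_tail_no_token n 1"
  proof -
    have "E n (up 0) = E n (\<lambda>x. lam - lam * (Z x * s 1 x))"
      by (intro E_cong[OF n]) (simp add: up_def algebra_simps)
    also have "\<dots> = lam - lam * mean_tail_no_token n 1"
      unfolding mean_tail_no_token_def by (subst E_diff) (intro bdd_intros | simp)+
    finally show ?thesis .
  qed
  have upS: "E n (up (Suc k)) = lam * mean_tail_no_token n (Suc k) - lam * mean_tail_no_token n (Suc (Suc k))" for k
  proof -
    have "E n (up (Suc k)) = E n (\<lambda>x. lam * (Z x * s (Suc k) x) - lam * (Z x * s (Suc (Suc k)) x))"
      by (intro E_cong[OF n]) (simp add: up_def algebra_simps)
    also have "\<dots> = lam * mean_tail_no_token n (Suc k) - lam * mean_tail_no_token n (Suc (Suc k))"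
      unfolding mean_tail_no_token_def by (subst E_diff) (intro bdd_intros | simp)+
    finally show ?thesis .
  qed
  define D where "D k = lam * mean_tail_no_token n (Suc k) - mean_tail n (Suc (Suc k))" for k
  have "D (Suc k) = D k" for k
    using E_up[OF n, of "Suc k"] unfolding upS D_def mean_tail_def by simp
  then have const: "D k = D 0" for k by (induction k) simp_all
  have "(\<lambda>k. mean_tail_no_token n k) \<longlonglongrightarrow> 0"
    by (rule tendsto_sandwich[OF _ _ tendsto_const mean_tail_tendsto_0[of n]]) (simp_all add: mean_tail_no_token_nonneg mean_tail_no_token_le)
  then have "(\<lambda>k. mean_tail_no_token n (Suc k)) \<longlonglongrightarrow> 0" "(\<lambda>k. mean_tail n (Suc (Suc k))) \<longlonglongrightarrow> 0"
    using LIMSEQ_Suc LIMSEQ_Suc[OF LIMSEQ_Suc[OF mean_tail_tendsto_0[of n]]] by blast+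
  then have "D \<longlonglongrightarrow> lam * 0 - 0" unfolding D_def by (intro tendsto_intros)
  moreover have "D \<longlonglongrightarrow> D 0" using const by (simp add: tendsto_cong[of D "\<lambda>_. D 0"])
  ultimately have D0: "D 0 = 0" using LIMSEQ_unique by fastforce
  then show "mean_tail n (Suc (Suc k)) = lam * mean_tail_no_token n (Suc k)" using const[of k] by (simp add: D_def)
  show "mean_tail n 1 = lam"
    using E_up[OF n, of 0] D0 unfolding up0 D_def mean_tail_def by simp
qed

text \<open>This geometric bound is uniform in \<open>n\<close>. It provides the domination for the series of the mean
  queue length, and it makes the truncation in the Lyapunov argument harmless.\<close>

lemma mean_tail_le:
  assumes n: "n \<ge> c" shows "mean_tail n (Suc k) \<le> lam ^ Suc k"
proof (induction k)
  case 0
  show ?case using flow_balance(1)[OF n] by simp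
next
  case (Suc k)
  have "mean_tail n (Suc (Suc k)) = lam * mean_tail_no_token n (Suc k)" by (rule flow_balance(2)[OF n])
  also have "\<dots> \<le> lam * lam ^ Suc k"
    using mean_tail_no_token_le[of n "Suc k"] Suc lam by (intro mult_left_mono) auto
  finally show ?case by simp
qed

definition \<rho> :: real where "\<rho> = \<mu> / lam"

lemma rho_pos: "\<rho> > 0" using lam mu by (simp add: \<rho>_def)

text \<open>Detailed balance of the token count, given the slow observables: the generator applied to
  \<open>G\<close> times the indicator of at least \<open>j + 1\<close> tokens is \<open>n\<close> times this difference, up to \<open>O(1)\<close>.\<close>

lemma token_balance:
  assumes G: "slow G" and j: "Suc j \<le> c"
  shows "(\<lambda>n. E n (\<lambda>x. G (fst x) * of_bool (snd x = Suc j))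
            - \<rho> * E n (\<lambda>x. G (fst x) * (1 - s 1 x) * of_bool (snd x = j))) \<longlonglongrightarrow> 0"
proof -
  obtain B where
    B: "\<And>q. \<bar>G q\<bar> \<le> B" "\<And>q i v. i < length q \<Longrightarrow> \<bar>G (q[i := v]) - G q\<bar> \<le> B / length q"
    by (rule slowE[OF G]) (rule that)
  define C where "C = B * (lam + 1 + \<mu> * c)"
  define T where "T x = G (fst x) * (lam * of_bool (snd x = Suc j) - \<mu> * (1 - s 1 x) * of_bool (snd x = j))" for x
  define A where "A = rcpb_gen lam c \<mu> (\<lambda>x. G (fst x) * of_bool (Suc j \<le> snd x))"
  have bT: "bdd T" unfolding T_def by (intro bdd_intros G)
  have bd: "\<bar>E n T\<bar> \<le> C / real n" if n: "n \<ge> c" for n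
  proof -
    have n0: "n > 0" using n c by simp
    have AT: "\<bar>A x + real n * T x\<bar> \<le> C" if "x \<in> rcpb_states n c" for x
      using rcpb_gen_tokens[of "fst x" "snd x" n c lam \<mu> j G B] that n0 lam mu j B
      by (simp add: A_def T_def C_def case_prod_beta')
    have ae: "AE x in \<pi> n. \<bar>A x + real n * T x\<bar> \<le> C"
      using supp[OF n] AT by (auto simp: AE_measure_pmf_iff)
    have i1: "integrable (\<pi> n) (\<lambda>x. A x + real n * T x)"
      by (rule measure_pmf.integrable_const_bound[where B = C]) (use ae in auto)
    have i2: "integrable (\<pi> n) (\<lambda>x. real n * T x)" by (intro integrable_bdd bdd_intros bT)
    have iA: "integrable (\<pi> n) A" using Bochner_Integration.integrable_diff[OF i1 i2] by simp
    have "B \<ge> 0" using B(1)[of "[]"] by linarith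
    then have "\<bar>G (fst x) * of_bool (Suc j \<le> snd x)\<bar> \<le> B" for x :: rcpb_state
      using B(1)[of "fst x"] by (simp add: abs_mult of_bool_def)
    then have "E n A = 0" unfolding A_def by (rule gen[OF n])
    then have "real n * E n T = E n (\<lambda>x. A x + real n * T x)"
      using iA i2 by simp
    also have "\<bar>\<dots>\<bar> \<le> E n (\<lambda>x. C)"
      using ae by (intro order_trans[OF integral_abs_bound] integral_mono_AE integrable_abs i1) auto
    finally have "real n * \<bar>E n T\<bar> \<le> C" by (simp add: abs_mult)
    then show ?thesis using n0 by (simp add: field_simps)
  qed
  have "(\<lambda>n. E n T) \<longlonglongrightarrow> 0"
    by (rule Lim_null_comparison[OF _ lim_const_over_n[of C]])
       (use bd in \<open>auto intro: eventually_sequentiallyI[of c]\<close>)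
  then have "(\<lambda>n. E n T / lam) \<longlonglongrightarrow> 0 / lam" by (intro tendsto_intros) (use lam in auto)
  moreover have "E n T / lam = E n (\<lambda>x. G (fst x) * of_bool (snd x = Suc j))
            - \<rho> * E n (\<lambda>x. G (fst x) * (1 - s 1 x) * of_bool (snd x = j))" for n
  proof -
    have "E n T = E n (\<lambda>x. lam * (G (fst x) * of_bool (snd x = Suc j)) -
       \<mu> * (G (fst x) * (1 - s 1 x) * of_bool (snd x = j)))"
      unfolding T_def by (simp add: algebra_simps)
    also have "\<dots> = lam * E n (\<lambda>x. G (fst x) * of_bool (snd x = Suc j)) -
       \<mu> * E n (\<lambda>x. G (fst x) * (1 - s 1 x) * of_bool (snd x = j))"
      by (subst E_diff) (intro bdd_intros G | simp)+
    finally show ?thesis using lam by (simp add: \<rho>_def field_simps)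
  qed
  ultimately show ?thesis by simp
qed

lemma token_distribution:
  assumes "slow G" "j \<le> c"
  shows "(\<lambda>n. E n (\<lambda>x. G (fst x) * of_bool (snd x = j))
            - \<rho> ^ j * E n (\<lambda>x. G (fst x) * (1 - s 1 x) ^ j * Z x)) \<longlonglongrightarrow> 0"
  using assms
proof (induction j arbitrary: G)
  case 0
  then show ?case by simp
next
  case (Suc j)
  let ?G = "\<lambda>q. G q * (1 - queue_fraction 1 q)"
  have "slow ?G" by (intro slow_mult slow_diff slow_const slow_queue_fraction Suc.prems)
  then have "(\<lambda>n. E n (\<lambda>x. ?G (fst x) * of_bool (snd x = j))
            - \<rho> ^ j * E n (\<lambda>x. ?G (fst x) * (1 - s 1 x) ^ j * Z x)) \<longlonglongrightarrow> 0"
    using Suc.prems by (intro Suc.IH) auto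
  then have "(\<lambda>n. (E n (\<lambda>x. G (fst x) * of_bool (snd x = Suc j))
            - \<rho> * E n (\<lambda>x. G (fst x) * (1 - s 1 x) * of_bool (snd x = j)))
      + \<rho> * (E n (\<lambda>x. ?G (fst x) * of_bool (snd x = j))
            - \<rho> ^ j * E n (\<lambda>x. ?G (fst x) * (1 - s 1 x) ^ j * Z x))) \<longlonglongrightarrow> 0 + \<rho> * 0"
    using Suc.prems by (intro tendsto_intros token_balance)
  then show ?case by (simp add: algebra_simps)
qed

definition p_none :: "rcpb_state \<Rightarrow> real" where "p_none x = empty_prob \<rho> c (s 1 x)"

lemma bdd_p_none: "bdd p_none"
  unfolding p_none_def using slow_empty_prob[of \<rho> c] rho_pos
  by (intro bdd_slow[of "\<lambda>q. empty_prob \<rho> c (queue_fraction 1 q)"]) auto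

text \<open>In the mean, the indicator \<open>Z\<close> of an empty token store may be replaced by the equilibrium
  probability \<open>p_none\<close> of the token chain with the current number of idle servers frozen. This is
  \<open>token_distribution\<close>, summed over \<open>j\<close>, for the test function \<open>H\<close> times \<open>p_none\<close>.\<close>

lemma no_token_averaging:
  assumes H: "slow H"
  shows "(\<lambda>n. E n (\<lambda>x. H (fst x) * Z x) - E n (\<lambda>x. H (fst x) * p_none x)) \<longlonglongrightarrow> 0"
proof -
  define G where "G q = H q * empty_prob \<rho> c (queue_fraction 1 q)" for q
  have G: "slow G" unfolding G_def using rho_pos by (intro slow_mult H slow_empty_prob) auto
  have "(\<lambda>n. \<Sum>j\<le>c. E n (\<lambda>x. G (fst x) * of_bool (snd x = j))
            - \<rho> ^ j * E n (\<lambda>x. G (fst x) * (1 - s 1 x) ^ j * Z x)) \<longlonglongrightarrow> (\<Sum>j\<le>c. 0)"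
    by (intro tendsto_sum token_distribution G) auto
  moreover have "(\<Sum>j\<le>c. E n (\<lambda>x. G (fst x) * of_bool (snd x = j))
            - \<rho> ^ j * E n (\<lambda>x. G (fst x) * (1 - s 1 x) ^ j * Z x))
     = E n (\<lambda>x. H (fst x) * p_none x) - E n (\<lambda>x. H (fst x) * Z x)" if n: "n \<ge> c" for n
  proof -
    have "(\<Sum>j\<le>c. E n (\<lambda>x. G (fst x) * of_bool (snd x = j)))
        = E n (\<lambda>x. \<Sum>j\<le>c. G (fst x) * of_bool (snd x = j))"
      by (intro E_sum[symmetric] bdd_intros G)
    also have "\<dots> = E n (\<lambda>x. H (fst x) * p_none x)"
    proof (rule E_cong[OF n])
      fix x assume "x \<in> rcpb_states n c"
      then have "snd x \<in> {..c}" by (auto simp: rcpb_states_def)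
      then have "(\<Sum>j\<le>c. of_bool (snd x = j)) = (1::real)" by (simp add: of_bool_def)
      then show "(\<Sum>j\<le>c. G (fst x) * of_bool (snd x = j)) = H (fst x) * p_none x"
        by (simp only: sum_distrib_left[symmetric]) (simp add: G_def p_none_def)
    qed
    finally have 1: "(\<Sum>j\<le>c. E n (\<lambda>x. G (fst x) * of_bool (snd x = j))) = E n (\<lambda>x. H (fst x) * p_none x)" .
    have "(\<Sum>j\<le>c. \<rho> ^ j * E n (\<lambda>x. G (fst x) * (1 - s 1 x) ^ j * Z x))
        = (\<Sum>j\<le>c. E n (\<lambda>x. \<rho> ^ j * (G (fst x) * (1 - s 1 x) ^ j * Z x)))" by simp
    also have "\<dots> = E n (\<lambda>x. \<Sum>j\<le>c. \<rho> ^ j * (G (fst x) * (1 - s 1 x) ^ j * Z x))"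
      by (intro E_sum[symmetric] bdd_mult[OF bdd_const] bdd_mult[OF _ bdd_of_bool]
           bdd_slow[of "\<lambda>q. G q * (1 - queue_fraction 1 q) ^ _"] slow_mult slow_power slow_diff
           slow_const slow_queue_fraction G)
    also have "\<dots> = E n (\<lambda>x. H (fst x) * Z x)"
    proof (rule E_cong[OF n])
      fix x :: rcpb_state
      let ?D = "\<Sum>j\<le>c. (\<rho> * (1 - s 1 x)) ^ j"
      have "(\<Sum>j\<le>c. \<rho> ^ j * (G (fst x) * (1 - s 1 x) ^ j * Z x)) = G (fst x) * ?D * Z x"
        by (simp add: sum_distrib_left sum_distrib_right power_mult_distrib mult_ac)
      also have "G (fst x) * ?D = H (fst x)"
        using empty_prob_denominator_ge_1[of \<rho> "s 1 x" c] rho_pos queue_fraction_le_1[of 1 "fst x"]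
        by (simp add: G_def empty_prob_def)
      finally show "(\<Sum>j\<le>c. \<rho> ^ j * (G (fst x) * (1 - s 1 x) ^ j * Z x)) = H (fst x) * Z x" .
    qed
    finally show ?thesis using 1 by (simp add: sum_subtractf)
  qed
  ultimately have "(\<lambda>n. E n (\<lambda>x. H (fst x) * p_none x) - E n (\<lambda>x. H (fst x) * Z x)) \<longlonglongrightarrow> (\<Sum>j\<le>c. 0)"
    by (rule Lim_transform_eventually[OF _ eventually_sequentiallyI[of c]])
  then have "(\<lambda>n. E n (\<lambda>x. H (fst x) * p_none x) - E n (\<lambda>x. H (fst x) * Z x)) \<longlonglongrightarrow> 0" by simp
  from tendsto_minus[OF this] show ?thesis by simp
qed

section \<open>Concentration of the fraction of busy servers\<close>

definition p_none_eq :: real where "p_none_eq = empty_prob \<rho> c lam"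

text \<open>The equilibrium of the fluid limit, shifted by one: \<open>eq_tail k\<close> is the limit of
  \<open>s (Suc k)\<close>.\<close>

definition eq_tail :: "nat \<Rightarrow> real" where "eq_tail k = lam * (lam * p_none_eq) ^ k"

definition dev :: "nat \<Rightarrow> rcpb_state \<Rightarrow> real" where "dev k x = s (Suc k) x - eq_tail k"

definition drift :: "nat \<Rightarrow> rcpb_state \<Rightarrow> real" where
  "drift k x = up k x - (s (Suc k) x - s (Suc (Suc k)) x)"

definition avg_drift :: "nat \<Rightarrow> rcpb_state \<Rightarrow> real" where
  "avg_drift k x = lam * (of_bool (k = 0) + p_none x * (of_bool (k \<noteq> 0) * s k x - s (Suc k) x))
     - (s (Suc k) x - s (Suc (Suc k)) x)"

lemma p_none_eq_bounds: "0 < p_none_eq" "p_none_eq \<le> 1"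
  using lam rho_pos by (auto simp: p_none_eq_def intro!: empty_prob_pos empty_prob_le_1)

lemma eq_tail_Suc: "eq_tail (Suc k) = lam * p_none_eq * eq_tail k" by (simp add: eq_tail_def)

lemma eq_tail_nonneg: "eq_tail k \<ge> 0" using lam p_none_eq_bounds by (simp add: eq_tail_def)

lemma eq_tail_decreasing: "eq_tail (Suc k) \<le> eq_tail k"
proof -
  have "lam * p_none_eq \<le> 1" using lam p_none_eq_bounds by (intro mult_le_one) auto
  then show ?thesis using mult_right_mono[of "lam * p_none_eq" 1 "eq_tail k"] eq_tail_nonneg[of k] by (simp add: eq_tail_Suc)
qed

lemma eq_tail_le: "eq_tail k \<le> lam ^ Suc k"
proof -
  have "(lam * p_none_eq) ^ k \<le> lam ^ k"
    using lam p_none_eq_bounds by (intro power_mono) (auto intro: mult_left_le)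
  then show ?thesis using lam by (simp add: eq_tail_def mult_left_mono)
qed

lemma slow_dev: "slow (\<lambda>q. queue_fraction (Suc k) q - eq_tail k)"
  by (intro slow_diff slow_queue_fraction slow_const)

lemma bdd_dev: "bdd (dev k)"
  unfolding dev_def by (intro bdd_intros)

lemma bdd_clip_dev: "\<epsilon> > 0 \<Longrightarrow> bdd (\<lambda>x. clip \<epsilon> (dev k x))"
  unfolding dev_def by (rule bdd_slow[of "\<lambda>q. clip \<epsilon> (queue_fraction (Suc k) q - eq_tail k)"])
    (intro slow_clip slow_dev)

lemma bdd_drift: "bdd (drift k)"
  unfolding drift_def by (intro bdd_intros bdd_up)

lemma bdd_avg_drift: "bdd (avg_drift k)"
  unfolding avg_drift_def by (intro bdd_intros bdd_p_none)

text \<open>The generator identity for \<open>huber \<epsilon> (dev k)\<close>: by convexity the second-order term is at most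
  \<open>2 / (\<epsilon> n)\<close>.\<close>

lemma lyapunov_step:
  assumes n: "n \<ge> c" and eps: "\<epsilon> > 0"
  shows "E n (\<lambda>x. clip \<epsilon> (dev k x) * drift k x) \<ge> - (2 / \<epsilon>) / real n"
proof -
  have n0: "n > 0" using n c by simp
  let ?h = "\<lambda>u. huber \<epsilon> (u - eq_tail k)"
  define F where "F x = real n * up k x * (?h (s (Suc k) x + 1 / n) - ?h (s (Suc k) x))
     + real n * (s (Suc k) x - s (Suc (Suc k)) x) * (?h (s (Suc k) x - 1 / n) - ?h (s (Suc k) x))" for x
  have bF: "bdd F"
    unfolding F_def
    by (intro bdd_intros bdd_up slow_huber eps)
  obtain B where B: "\<And>x. \<bar>?h (s (Suc k) x)\<bar> \<le> B"
    by (rule bddE[OF bdd_slow[OF slow_huber[OF eps slow_dev]]]) (rule that)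
  have "0 = E n (rcpb_gen lam c \<mu> (\<lambda>x. ?h (s (Suc k) x)))"
    by (rule gen[OF n B, symmetric])
  also have "\<dots> = E n F"
    unfolding F_def by (intro E_cong[OF n] gen_queue_fraction[OF n])
  also have "\<dots> \<le> E n (\<lambda>x. clip \<epsilon> (dev k x) * drift k x + (2 / \<epsilon>) / real n)"
  proof (rule E_mono[OF n bF])
    show "bdd (\<lambda>x. clip \<epsilon> (dev k x) * drift k x + (2 / \<epsilon>) / real n)"
      by (intro bdd_intros bdd_clip_dev eps bdd_drift)
    fix x assume x: "x \<in> rcpb_states n c"
    define w where "w = s (Suc k) x - s (Suc (Suc k)) x"
    have w: "0 \<le> w" "w \<le> 1"
      using queue_fraction_antimono[of "Suc k" "Suc (Suc k)" "fst x"]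
        queue_fraction_le_1[of "Suc k" "fst x"] queue_fraction_nonneg[of "Suc (Suc k)" "fst x"]
      unfolding w_def by auto
    note u = up_bounds[OF n x, of k]
    have step: "real n * v * (?h (s (Suc k) x + z / n) - ?h (s (Suc k) x))
        \<le> v * (z * clip \<epsilon> (dev k x)) + (1 / \<epsilon>) / real n" if v: "0 \<le> v" "v \<le> 1" and z: "z\<^sup>2 = 1" for v z
    proof -
      have "?h (s (Suc k) x + z / n) - ?h (s (Suc k) x) \<le> z / n * clip \<epsilon> (dev k x) + (z / n)\<^sup>2 / \<epsilon>"
        using huber_step_le[OF eps, of "dev k x" "z / n"] by (simp add: dev_def algebra_simps)
      then have "real n * v * (?h (s (Suc k) x + z / n) - ?h (s (Suc k) x))
          \<le> real n * v * (z / n * clip \<epsilon> (dev k x) + (z / n)\<^sup>2 / \<epsilon>)"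
        using v by (intro mult_left_mono) auto
      also have "\<dots> = v * (z * clip \<epsilon> (dev k x)) + v * ((1 / \<epsilon>) / real n)"
        using n0 z by (simp add: power_divide) (simp add: field_simps power2_eq_square)
      also have "v * ((1 / \<epsilon>) / real n) \<le> (1 / \<epsilon>) / real n"
        using v eps by (intro mult_left_le_one_le) auto
      finally show ?thesis by simp
    qed
    have "F x \<le> (up k x * (1 * clip \<epsilon> (dev k x)) + (1 / \<epsilon>) / real n) + (w * (- 1 * clip \<epsilon> (dev k x)) + (1 / \<epsilon>) / real n)"
      unfolding F_def w_def[symmetric]
      using step[OF u, of 1] step[OF w, of "- 1"] by (intro add_mono) simp_all
    also have "\<dots> = clip \<epsilon> (dev k x) * drift k x + (2 / \<epsilon>) / real n"
      by (simp add: drift_def w_def[symmetric] algebra_simps)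
    finally show "F x \<le> clip \<epsilon> (dev k x) * drift k x + (2 / \<epsilon>) / real n" .
  qed
  also have "\<dots> = E n (\<lambda>x. clip \<epsilon> (dev k x) * drift k x) + (2 / \<epsilon>) / real n"
    by (subst E_add) (intro bdd_intros bdd_clip_dev eps bdd_drift | simp)+
  finally show ?thesis by simp
qed

lemma drift_averaging:
  assumes eps: "\<epsilon> > 0"
  shows "(\<lambda>n. E n (\<lambda>x. clip \<epsilon> (dev k x) * drift k x) - E n (\<lambda>x. clip \<epsilon> (dev k x) * avg_drift k x)) \<longlonglongrightarrow> 0"
proof -
  define H where "H q = clip \<epsilon> (queue_fraction (Suc k) q - eq_tail k)
      * (of_bool (k \<noteq> 0) * queue_fraction k q - queue_fraction (Suc k) q)" for q
  have H: "slow H"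
    unfolding H_def by (intro slow_mult slow_diff slow_clip slow_dev slow_const slow_queue_fraction eps)
  have "(\<lambda>n. lam * (E n (\<lambda>x. H (fst x) * Z x) - E n (\<lambda>x. H (fst x) * p_none x))) \<longlonglongrightarrow> lam * 0"
    by (intro tendsto_mult_left no_token_averaging H)
  moreover have "lam * (E n (\<lambda>x. H (fst x) * Z x) - E n (\<lambda>x. H (fst x) * p_none x))
    = E n (\<lambda>x. clip \<epsilon> (dev k x) * drift k x) - E n (\<lambda>x. clip \<epsilon> (dev k x) * avg_drift k x)" for n
  proof -
    have b1: "bdd (\<lambda>x. H (fst x) * Z x)" and b2: "bdd (\<lambda>x. H (fst x) * p_none x)"
      by (intro bdd_intros H bdd_p_none)+
    have b3: "bdd (\<lambda>x. clip \<epsilon> (dev k x) * drift k x)" and b4: "bdd (\<lambda>x. clip \<epsilon> (dev k x) * avg_drift k x)"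
      by (intro bdd_mult bdd_clip_dev eps bdd_drift bdd_avg_drift)+
    have "lam * (E n (\<lambda>x. H (fst x) * Z x) - E n (\<lambda>x. H (fst x) * p_none x))
        = E n (\<lambda>x. lam * (H (fst x) * Z x - H (fst x) * p_none x))"
      by (simp add: E_diff[OF b1 b2])
    also have "(\<lambda>x. lam * (H (fst x) * Z x - H (fst x) * p_none x))
        = (\<lambda>x. clip \<epsilon> (dev k x) * drift k x - clip \<epsilon> (dev k x) * avg_drift k x)"
      by (rule ext) (simp add: H_def drift_def avg_drift_def dev_def up_def algebra_simps)
    finally show ?thesis by (simp only: E_diff[OF b3 b4])
  qed
  ultimately show ?thesis by simp
qed

definition Lip :: real where "Lip = (\<Sum>j\<le>c. \<rho> ^ j * real j)"

lemma Lip_nonneg: "Lip \<ge> 0"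
  unfolding Lip_def using rho_pos by (intro sum_nonneg) auto

lemma p_none_bounds: "0 \<le> p_none x" "p_none x \<le> 1"
  using rho_pos by (auto simp: p_none_def queue_fraction_le_1 intro!: less_imp_le[OF empty_prob_pos] empty_prob_le_1)

lemma p_none_lipschitz: "\<bar>p_none x - p_none_eq\<bar> \<le> Lip * \<bar>s 1 x - lam\<bar>"
  unfolding p_none_def p_none_eq_def Lip_def using rho_pos lam
  by (intro empty_prob_lipschitz) (auto simp: queue_fraction_nonneg queue_fraction_le_1)

lemma p_none_monotone: "(p_none x - p_none_eq) * (s 1 x - lam) \<ge> 0"
proof (cases "s 1 x \<le> lam")
  case True
  then have "p_none x \<le> p_none_eq" unfolding p_none_def p_none_eq_def using rho_pos lam by (intro empty_prob_mono) auto
  then show ?thesis using True by (intro mult_nonpos_nonpos) auto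
next
  case False
  then have "p_none_eq \<le> p_none x" unfolding p_none_def p_none_eq_def using rho_pos
    by (intro empty_prob_mono) (auto simp: queue_fraction_le_1)
  then show ?thesis using False by (intro mult_nonneg_nonneg) auto
qed

lemma sum_clip_avg_drift_le:
  assumes eps: "\<epsilon> > 0"
  shows "(\<Sum>k\<le>K. clip \<epsilon> (dev k x) * avg_drift k x)
     \<le> - \<bar>s 1 x - lam\<bar> + \<bar>dev (Suc K) x\<bar> + (1 + 2 * real K + Lip) * \<epsilon>"
proof -
  have e0: "eq_tail 0 = lam" by (simp add: eq_tail_def)
  have "(\<Sum>k\<le>K. clip \<epsilon> (dev k x) * avg_drift k x)
     \<le> - \<bar>dev 0 x\<bar> + \<bar>dev (Suc K) x\<bar> + (1 + 2 * real K + Lip) * \<epsilon>"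
  proof (rule drift_inequality[where U = "\<lambda>k. lam * (p_none x * dev k x + (p_none x - p_none_eq) * eq_tail k)"
        and l = lam and p = "p_none x" and \<delta> = "p_none x - p_none_eq" and e = eq_tail and d = "\<lambda>k. dev k x" and b = "\<lambda>k. avg_drift k x"])
    show "avg_drift 0 x = - (lam * (p_none x * dev 0 x + (p_none x - p_none_eq) * eq_tail 0)) - dev 0 x + dev 1 x"
      by (simp add: avg_drift_def dev_def eq_tail_Suc e0 algebra_simps)
    show "avg_drift (Suc k) x = lam * (p_none x * dev k x + (p_none x - p_none_eq) * eq_tail k)
        - lam * (p_none x * dev (Suc k) x + (p_none x - p_none_eq) * eq_tail (Suc k)) - dev (Suc k) x + dev (Suc (Suc k)) x" for k
      by (simp add: avg_drift_def dev_def eq_tail_Suc algebra_simps)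
    show "0 \<le> (p_none x - p_none_eq) * dev 0 x" using p_none_monotone[of x] by (simp add: dev_def e0)
    show "\<bar>p_none x - p_none_eq\<bar> \<le> Lip * \<bar>dev 0 x\<bar>" using p_none_lipschitz[of x] by (simp add: dev_def e0)
  qed (use eps lam p_none_bounds eq_tail_nonneg eq_tail_decreasing e0 Lip_nonneg in auto)
  then show ?thesis by (simp add: dev_def e0)
qed

text \<open>The drift of the smoothed \<open>\<ell>\<^sup>1\<close> distance of \<open>s 1\<close>, ..., \<open>s (K + 1)\<close> to the equilibrium has a
  stationary mean of at least \<open>- O(1 / n)\<close>, and token averaging changes it by \<open>o(1)\<close>, while \<open>sum_clip_avg_drift_le\<close> bounds it above by \<open>- \<bar>s 1 x - lam\<bar>\<close> plus a
  small error. The order of choices is \<open>K\<close>, then \<open>\<epsilon>\<close>, then \<open>n\<close>.\<close>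

lemma concentration: "(\<lambda>n. E n (\<lambda>x. \<bar>s 1 x - lam\<bar>)) \<longlonglongrightarrow> 0"
proof (rule LIMSEQ_I)
  fix \<eta> :: real assume \<eta>: "\<eta> > 0"
  \<comment> \<open>twice \<open>lam ^ K\<close> bounds the truncation error, which gets a third of \<open>\<eta>\<close>\<close>
  obtain K where K: "lam ^ K < \<eta> / 6"
    using real_arch_pow_inv[of "\<eta> / 6" lam] lam \<eta> by auto
  define \<epsilon> where "\<epsilon> = \<eta> / 3 / (1 + 2 * real K + Lip)"
  have pos: "1 + 2 * real K + Lip > 0" using Lip_nonneg by linarith
  have eps: "\<epsilon> > 0" unfolding \<epsilon>_def using \<eta> pos by simp
  have "C * (\<eta> / 3 / C) = \<eta> / 3" if "C > 0" for C
    using that by simp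
  from this[OF pos] have Ceps: "(1 + 2 * real K + Lip) * \<epsilon> = \<eta> / 3"
    unfolding \<epsilon>_def .
  define W where "W k n = E n (\<lambda>x. clip \<epsilon> (dev k x) * avg_drift k x)" for k n
  define V where "V k n = E n (\<lambda>x. clip \<epsilon> (dev k x) * drift k x)" for k n
  have "(\<lambda>n. \<Sum>k\<le>K. (V k n - W k n) + (2 / \<epsilon>) / real n) \<longlonglongrightarrow> (\<Sum>k\<le>K. 0 + 0)"
    unfolding V_def W_def by (intro tendsto_sum tendsto_add drift_averaging eps lim_const_over_n)
  then have "(\<lambda>n. \<Sum>k\<le>K. (V k n - W k n) + (2 / \<epsilon>) / real n) \<longlonglongrightarrow> 0" by simp
  then have "eventually (\<lambda>n. (\<Sum>k\<le>K. (V k n - W k n) + (2 / \<epsilon>) / real n) < \<eta> / 3) sequentially"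
    by (rule order_tendstoD(2)) (use \<eta> in auto)
  then obtain N where N: "\<And>n. n \<ge> N \<Longrightarrow> (\<Sum>k\<le>K. (V k n - W k n) + (2 / \<epsilon>) / real n) < \<eta> / 3"
    unfolding eventually_sequentially by auto
  have "E n (\<lambda>x. \<bar>s 1 x - lam\<bar>) < \<eta>" if n: "n \<ge> max N c" for n
  proof -
    have nc: "n \<ge> c" using n by simp
    have "(\<Sum>k\<le>K. - W k n) \<le> (\<Sum>k\<le>K. (V k n - W k n) + (2 / \<epsilon>) / real n)"
    proof (rule sum_mono)
      fix k
      show "- W k n \<le> (V k n - W k n) + (2 / \<epsilon>) / real n"
        using lyapunov_step[OF nc eps, of k] unfolding V_def[symmetric] minus_divide_left[symmetric]
        by linarith
    qed
    then have "(\<Sum>k\<le>K. - W k n) < \<eta> / 3" using N[of n] n by simp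
    then have W: "- (\<Sum>k\<le>K. W k n) < \<eta> / 3" by (simp add: sum_negf)
    have bW: "bdd (\<lambda>x. clip \<epsilon> (dev k x) * avg_drift k x)" for k
      by (intro bdd_mult bdd_clip_dev eps bdd_avg_drift)
    have bs: "bdd (\<lambda>x. \<bar>s 1 x - lam\<bar>)" by (intro bdd_intros)
    have bd: "bdd (\<lambda>x. \<bar>dev (Suc K) x\<bar>)" by (intro bdd_abs bdd_dev)
    have "(\<Sum>k\<le>K. W k n) = E n (\<lambda>x. \<Sum>k\<le>K. clip \<epsilon> (dev k x) * avg_drift k x)"
      unfolding W_def by (intro E_sum[symmetric] bW)
    also have "\<dots> \<le> E n (\<lambda>x. (\<bar>dev (Suc K) x\<bar> - \<bar>s 1 x - lam\<bar>) + \<eta> / 3)"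
      using sum_clip_avg_drift_le[OF eps, where K = K] unfolding Ceps
      by (intro E_mono[OF nc] bdd_sum bW bdd_add bdd_diff bd bs bdd_const) (simp add: algebra_simps)
    also have "\<dots> = E n (\<lambda>x. \<bar>dev (Suc K) x\<bar>) - E n (\<lambda>x. \<bar>s 1 x - lam\<bar>) + \<eta> / 3"
      using E_diff[OF bd bs, of n] E_add[OF bdd_diff[OF bd bs] bdd_const[of "\<eta> / 3"], of n] by simp
    finally have main: "E n (\<lambda>x. \<bar>s 1 x - lam\<bar>) < E n (\<lambda>x. \<bar>dev (Suc K) x\<bar>) + 2 * \<eta> / 3"
      using W by linarith
    have "E n (\<lambda>x. \<bar>dev (Suc K) x\<bar>) \<le> E n (\<lambda>x. s (Suc (Suc K)) x + eq_tail (Suc K))"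
      using queue_fraction_nonneg eq_tail_nonneg
      by (intro E_mono[OF nc] bd bdd_intros) (auto simp: dev_def abs_le_iff intro: order_trans[of _ 0] add_nonneg_nonneg)
    also have "\<dots> = mean_tail n (Suc (Suc K)) + eq_tail (Suc K)"
      unfolding mean_tail_def by (subst E_add) (intro bdd_intros | simp)+
    also have "\<dots> \<le> lam ^ Suc (Suc K) + lam ^ Suc (Suc K)"
      by (intro add_mono mean_tail_le[OF nc] eq_tail_le)
    also have "lam ^ Suc (Suc K) \<le> lam ^ K" using lam by (intro power_decreasing) auto
    finally show ?thesis using main K by linarith
  qed
  moreover have "E n (\<lambda>x. \<bar>s 1 x - lam\<bar>) \<ge> 0" for n by (intro Bochner_Integration.integral_nonneg) simp
  ultimately show "\<exists>no. \<forall>n\<ge>no. norm (E n (\<lambda>x. \<bar>s 1 x - lam\<bar>) - 0) < \<eta>"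
    by (intro exI[of _ "max N c"]) (auto simp del: max.bounded_iff)
qed

section \<open>The limit of the mean delay\<close>

text \<open>Once \<open>p_none\<close> is asymptotically constant, \<open>flow_balance\<close> becomes a geometric recursion.\<close>

lemma mean_tail_limit: "(\<lambda>n. mean_tail n (Suc k)) \<longlonglongrightarrow> eq_tail k"
proof (induction k)
  case 0
  have "eventually (\<lambda>n. mean_tail n 1 = eq_tail 0) sequentially"
    by (rule eventually_sequentiallyI[of c]) (use flow_balance(1) in \<open>simp add: eq_tail_def\<close>)
  then show ?case by (simp add: tendsto_eventually)
next
  case (Suc k)
  let ?s = "s (Suc k)"
  have 1: "(\<lambda>n. E n (\<lambda>x. ?s x * Z x) - E n (\<lambda>x. ?s x * p_none x)) \<longlonglongrightarrow> 0"
    by (rule no_token_averaging[OF slow_queue_fraction])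
  have 2: "(\<lambda>n. E n (\<lambda>x. ?s x * p_none x) - p_none_eq * mean_tail n (Suc k)) \<longlonglongrightarrow> 0"
  proof (rule Lim_null_comparison)
    have "\<bar>E n (\<lambda>x. ?s x * p_none x) - p_none_eq * mean_tail n (Suc k)\<bar> \<le> Lip * E n (\<lambda>x. \<bar>s 1 x - lam\<bar>)" for n
    proof -
      have bb: "bdd (\<lambda>x. ?s x * p_none x)" "bdd (\<lambda>x. p_none_eq * ?s x)" by (intro bdd_intros bdd_p_none)+
      have "E n (\<lambda>x. ?s x * p_none x) - p_none_eq * mean_tail n (Suc k) = E n (\<lambda>x. ?s x * p_none x - p_none_eq * ?s x)"
        by (simp add: mean_tail_def E_diff[OF bb])
      also have "\<bar>\<dots>\<bar> \<le> E n (\<lambda>x. \<bar>?s x * p_none x - p_none_eq * ?s x\<bar>)"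
        by (intro abs_E_le bdd_diff bb)
      also have "\<dots> \<le> E n (\<lambda>x. Lip * \<bar>s 1 x - lam\<bar>)"
      proof (intro integral_mono integrable_bdd bdd_abs bdd_diff bb)
        show "bdd (\<lambda>x. Lip * \<bar>s 1 x - lam\<bar>)" by (intro bdd_intros)
        show "\<bar>?s x * p_none x - p_none_eq * ?s x\<bar> \<le> Lip * \<bar>s 1 x - lam\<bar>" for x
        proof -
          have "\<bar>?s x * p_none x - p_none_eq * ?s x\<bar> = \<bar>?s x * (p_none x - p_none_eq)\<bar>" by (simp add: algebra_simps)
          also have "\<dots> = ?s x * \<bar>p_none x - p_none_eq\<bar>" by (simp add: abs_mult queue_fraction_nonneg)
          also have "\<dots> \<le> 1 * \<bar>p_none x - p_none_eq\<bar>" by (intro mult_right_mono queue_fraction_le_1) simp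
          finally show ?thesis using p_none_lipschitz[of x] by simp
        qed
      qed
      finally show ?thesis by simp
    qed
    then show "eventually (\<lambda>n. norm (E n (\<lambda>x. ?s x * p_none x) - p_none_eq * mean_tail n (Suc k))
        \<le> Lip * E n (\<lambda>x. \<bar>s 1 x - lam\<bar>)) sequentially" by simp
    show "(\<lambda>n. Lip * E n (\<lambda>x. \<bar>s 1 x - lam\<bar>)) \<longlonglongrightarrow> 0"
      using tendsto_mult_left[OF concentration, of Lip] by simp
  qed
  have "(\<lambda>n. lam * ((E n (\<lambda>x. ?s x * Z x) - E n (\<lambda>x. ?s x * p_none x))
       + (E n (\<lambda>x. ?s x * p_none x) - p_none_eq * mean_tail n (Suc k)) + p_none_eq * mean_tail n (Suc k))) \<longlonglongrightarrow> lam * (0 + 0 + p_none_eq * eq_tail k)"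
    by (intro tendsto_mult_left tendsto_add 1 2 Suc)
  then have "(\<lambda>n. lam * mean_tail_no_token n (Suc k)) \<longlonglongrightarrow> eq_tail (Suc k)"
    by (simp add: mean_tail_no_token_def eq_tail_Suc mult.commute[of "of_bool _"] mult.assoc)
  then show ?case
    by (rule Lim_transform_eventually[OF _ eventually_sequentiallyI[of c]])
       (simp add: flow_balance(2))
qed

lemma mean_delay_eq:
  assumes n: "n \<ge> c"
  shows "mean_delay lam (\<pi> n) = ereal (1 / lam * (\<Sum>k. mean_tail n (Suc k)) - 1)"
proof -
  have sm: "summable (\<lambda>k. mean_tail n (Suc k))"
  proof (rule summable_comparison_test)
    show "\<exists>N. \<forall>k\<ge>N. norm (mean_tail n (Suc k)) \<le> lam ^ Suc k"
      using mean_tail_le[OF n] mean_tail_nonneg by simp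
    show "summable (\<lambda>k. lam ^ Suc k)" using lam by (intro summable_Suc_iff[THEN iffD2] summable_geometric) auto
  qed
  have "(\<integral>\<^sup>+ (q, m). (\<Sum>i. ennreal (queue_fraction (Suc i) q)) \<partial>measure_pmf (\<pi> n))
      = (\<integral>\<^sup>+ x. (\<Sum>i. ennreal (s (Suc i) x)) \<partial>measure_pmf (\<pi> n))"
    by (simp add: case_prod_beta')
  also have "\<dots> = (\<Sum>i. \<integral>\<^sup>+ x. ennreal (s (Suc i) x) \<partial>measure_pmf (\<pi> n))"
    by (rule nn_integral_suminf) simp
  also have "\<dots> = (\<Sum>i. ennreal (mean_tail n (Suc i)))"
    unfolding mean_tail_def by (intro suminf_cong nn_integral_eq_integral integrable_bdd bdd_intros)
      (simp add: queue_fraction_nonneg)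
  also have "\<dots> = ennreal (\<Sum>i. mean_tail n (Suc i))"
    by (rule suminf_ennreal2) (simp_all add: mean_tail_nonneg sm)
  finally show ?thesis
    unfolding mean_delay_def by (simp add: enn2ereal_ennreal suminf_nonneg[OF sm] mean_tail_nonneg one_ereal_def)
qed

lemma asymptotic_delay_eq:
  "asymptotic_delay lam \<pi> = ereal (1 / (1 - lam * p_none_eq) - 1)"
proof -
  have lp: "0 \<le> lam * p_none_eq" "lam * p_none_eq < 1"
    using lam p_none_eq_bounds mult_left_mono[of p_none_eq 1 lam] by (simp, linarith)
  have "(\<lambda>n. \<Sum>k. if n \<ge> c then mean_tail n (Suc k) else 0) \<longlonglongrightarrow> (\<Sum>k. eq_tail k)"
  proof -
    have "eventually (\<lambda>(k, n). norm (if n \<ge> c then mean_tail n (Suc k) else 0) \<le> lam ^ Suc k) (at_top \<times>\<^sub>F sequentially)"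
      using mean_tail_le mean_tail_nonneg lam by (intro always_eventually) auto
    moreover have "(\<lambda>n. if n \<ge> c then mean_tail n (Suc k) else 0) \<longlonglongrightarrow> eq_tail k" for k
      by (rule Lim_transform_eventually[OF mean_tail_limit eventually_sequentiallyI[of c]]) simp
    moreover have "summable (\<lambda>k. lam ^ Suc k)"
      using lam by (intro summable_Suc_iff[THEN iffD2] summable_geometric) auto
    ultimately show ?thesis
      using tannerys_theorem[of "\<lambda>k n. if n \<ge> c then mean_tail n (Suc k) else 0" eq_tail sequentially "\<lambda>k. lam ^ Suc k"]
      by simp
  qed
  moreover have "(\<Sum>k. eq_tail k) = lam / (1 - lam * p_none_eq)"
    unfolding eq_tail_def using lp suminf_geometric[of "lam * p_none_eq"] summable_geometric[of "lam * p_none_eq"]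
    by (simp add: suminf_mult)
  ultimately have "(\<lambda>n. ereal (1 / lam * (\<Sum>k. if n \<ge> c then mean_tail n (Suc k) else 0) - 1))
      \<longlonglongrightarrow> ereal (1 / lam * (lam / (1 - lam * p_none_eq)) - 1)"
    by (intro tendsto_ereal tendsto_intros) simp
  then have "(\<lambda>n. mean_delay lam (\<pi> n)) \<longlonglongrightarrow> ereal (1 / lam * (lam / (1 - lam * p_none_eq)) - 1)"
    by (rule Lim_transform_eventually[OF _ eventually_sequentiallyI[of c]]) (simp add: mean_delay_eq)
  then have "limsup (\<lambda>n. mean_delay lam (\<pi> n)) = ereal (1 / lam * (lam / (1 - lam * p_none_eq)) - 1)"
    by (rule lim_imp_Limsup[OF sequentially_bot])
  then show ?thesis using lam by (simp add: asymptotic_delay_def)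
qed

end

theorem mainTheorem2:
  fixes lam \<alpha> :: real and c :: nat
    and P :: "nat \<Rightarrow> real \<Rightarrow> rcpb_state \<Rightarrow> rcpb_state pmf"
    and \<pi> :: "nat \<Rightarrow> rcpb_state pmf"
  assumes "0 < lam" and "lam < 1" and "\<alpha> > 0" and "c \<ge> 1"
    and "\<And>n. n \<ge> c \<Longrightarrow> rcpb_chain lam c (\<alpha> / (1 - lam)) n (P n)"
    and "\<And>n. n \<ge> c \<Longrightarrow> stationary_distribution (rcpb_states n c) (P n) (\<pi> n)"
  shows "asymptotic_delay lam \<pi> =
    ereal (lam * inverse (1 - lam + (\<Sum>k=1..c. (\<alpha> / lam) ^ k)))"
proof -
  let ?\<mu> = "\<alpha> / (1 - lam)"
  have mu: "?\<mu> > 0" using assms by simp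
  interpret rcpb_stationary lam ?\<mu> c \<pi>
  proof
    show "set_pmf (\<pi> n) \<subseteq> rcpb_states n c" if "n \<ge> c" for n
      using assms(6)[OF that] by (simp add: stationary_distribution_def)
    show "measure_pmf.expectation (\<pi> n) (rcpb_gen lam c ?\<mu> f) = 0"
      if "n \<ge> c" "\<And>x. \<bar>f x\<bar> \<le> B" for n f B
      by (rule stationary_rcpb_gen[OF assms(5,6)[OF that(1)] _ _ that(2)]) (use assms mu in auto)
  qed (use assms mu in auto)
  define R where "R = (\<Sum>k=1..c. (\<alpha> / lam) ^ k)"
  have "\<rho> * (1 - lam) = \<alpha> / lam" using assms by (simp add: \<rho>_def)
  moreover have "{..c} = insert 0 {1..c}" by auto
  ultimately have p_eq: "p_none_eq = inverse (1 + R)"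
    by (simp add: p_none_eq_def empty_prob_def R_def)
  have "R \<ge> 0" unfolding R_def using assms by (intro sum_nonneg) auto
  then have "1 / (1 - lam * p_none_eq) - 1 = lam * inverse (1 - lam + R)"
    unfolding p_eq using assms by (simp add: field_simps)
  then show ?thesis unfolding asymptotic_delay_eq R_def by simp
qed

end
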